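(* Let $s\in\mathbb{N}$. Consider the integration problem $I_k$ over the space $H^s$ of non-periodic functions. There is a number $c_s>0$, depending only on $s$, such that $\frac{c_s}{(n+|k|)^s}\le\tilde e(n,k,s)$ for all $k\in\mathbb{Z}$ and $n\in\mathbb{N}$ (a constant for the periodic problem), and with this $c_s$ $$\frac{c_s}{(n+|k|)^s}\;\le\;e(n,k,s)\;\le\;\left(\frac3{2\pi}\right)^s\frac{2}{(n+|k|-2s+1)^s}$$ for all $k\in\mathbb{Z}$ and all integers $n\ge2s$.
   Context: For $s\in\mathbb{N}=\{1,2,\dots\}$ let $H^s=\{f:[0,1]\to\mathbb{C} : f^{(s-1)}\text{ is absolutely continuous},\ f^{(s)}\in L_2([0,1])\}$ with inner product $$\langle f,g\rangle_s=\sum_{\ell=0}^{s-1}\int_0^1 f^{(\ell)}(x)\,dx\ \int_0^1\overline{g^{(\ell)}(x)}\,dx+\int_0^1 f^{(s)}(x)\,\overline{g^{(s)}(x)}\,dx$$ and norm $\|f\|_{H^s}=\langle f,f\rangle_s^{1/2}$. The periodic subspace is $\widetilde H^s=\{f\in H^s : f^{(\ell)}(0)=f^{(\ell)}(1)\text{ for }\ell=0,\dots,s-1\}$ with the same inner product. For $k\in\mathbb{Z}$, $I_k(f)=\int_0^1 f(x)\,e^{-2\pi i kx}\,dx$. Algorithms using $n$ values have the form $A_n(f)=\sum_{j=1}^n a_j f^{(\ell_j)}(x_j)$ with $a_j\in\mathbb{C}$, $\ell_j\in\{0,\dots,s-1\}$, $x_j\in[0,1]$ (all of which may depend on $k,s,n$).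 The $n$th minimal worst case errors over $H^s$ and over $\widetilde H^s$ are $$e(n,k,s)=\inf_{A_n}\ \sup_{f\in H^s,\ \|f\|_{H^s}\le1}|I_k(f)-A_n(f)|,\qquad \tilde e(n,k,s)=\inf_{A_n}\ \sup_{f\in\widetilde H^s,\ \|f\|_{H^s}\le1}|I_k(f)-A_n(f)|.$$ *)

theory Defs
  imports "HOL-Analysis.Analysis"
begin

text \<open>Functions on the unit interval are total functions on the reals of which only the values on
  \<^term>\<open>{0..1::real}\<close> matter: all derivatives are taken within that interval (hence one-sided at
  the end points) and all integrals are over it.\<close>

definition nderiv :: "nat \<Rightarrow> (real \<Rightarrow> complex) \<Rightarrow> real \<Rightarrow> complex" where
  "nderiv l f = ((\<lambda>g x. vector_derivative g (at x within {0..1})) ^^ l) f"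

definition abs_continuous_on :: "real set \<Rightarrow> (real \<Rightarrow> 'a::metric_space) \<Rightarrow> bool" where
  "abs_continuous_on S f \<longleftrightarrow>
     (\<forall>\<epsilon>>0. \<exists>\<delta>>0. \<forall>(m::nat) a b.
        (\<forall>i<m. a i \<le> b i \<and> {a i..b i} \<subseteq> S) \<and>
        disjoint_family_on (\<lambda>i. {a i<..<b i}) {..<m} \<and>
        (\<Sum>i<m. b i - a i) < \<delta> \<longrightarrow>
        (\<Sum>i<m. dist (f (a i)) (f (b i))) < \<epsilon>)"

definition square_integrable :: "(real \<Rightarrow> complex) \<Rightarrow> bool" where
  "square_integrable g \<longleftrightarrow>
     set_borel_measurable lebesgue {0..1} g \<and>
     set_integrable lebesgue {0..1} (\<lambda>x. (cmod (g x))\<^sup>2)"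

text \<open>The function \<^term>\<open>nderiv s f\<close> takes arbitrary values at points where the derivative does not
  exist. Almost everywhere existence already follows from absolute continuity; it is
  listed as part of the meaning of the \<open>s\<close>-th derivative being an element of \<open>L\<^sub>2\<close>.\<close>

definition sobolev :: "nat \<Rightarrow> (real \<Rightarrow> complex) set" where
  "sobolev s = {f.
     (\<forall>l<s - 1. \<forall>x\<in>{0..1}. nderiv l f differentiable (at x within {0..1})) \<and>
     abs_continuous_on {0..1} (nderiv (s - 1) f) \<and>
     (AE x in lebesgue. x \<in> {0..1} \<longrightarrow> nderiv (s - 1) f differentiable (at x within {0..1})) \<and>
     square_integrable (nderiv s f)}"

definition periodic_sobolev :: "nat \<Rightarrow> (real \<Rightarrow> complex) set" where
  "periodic_sobolev s = {f \<in> sobolev s. \<forall>l<s. nderiv l f 0 = nderiv l f 1}"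

definition sobolev_inner :: "nat \<Rightarrow> (real \<Rightarrow> complex) \<Rightarrow> (real \<Rightarrow> complex) \<Rightarrow> complex" where
  "sobolev_inner s f g =
     (\<Sum>l<s. (LINT x:{0..1}|lebesgue. nderiv l f x) * (LINT x:{0..1}|lebesgue. cnj (nderiv l g x)))
     + (LINT x:{0..1}|lebesgue. nderiv s f x * cnj (nderiv s g x))"

definition sobolev_norm :: "nat \<Rightarrow> (real \<Rightarrow> complex) \<Rightarrow> real" where
  "sobolev_norm s f = sqrt (Re (sobolev_inner s f f))"

definition osc_integral :: "int \<Rightarrow> (real \<Rightarrow> complex) \<Rightarrow> complex" where
  "osc_integral k f =
     (LINT x:{0..1}|lebesgue. f x * exp (- 2 * of_real pi * \<i> * of_int k * of_real x))"

definition algorithms :: "nat \<Rightarrow> nat \<Rightarrow> ((real \<Rightarrow> complex) \<Rightarrow> complex) set" where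
  "algorithms n s = {A. \<exists>(a :: nat \<Rightarrow> complex) (l :: nat \<Rightarrow> nat) (x :: nat \<Rightarrow> real).
     (\<forall>j\<in>{1..n}. l j < s \<and> x j \<in> {0..1}) \<and>
     A = (\<lambda>f. \<Sum>j=1..n. a j * nderiv (l j) f (x j))}"

text \<open>Errors are extended reals, so that no boundedness has to be shown for the supremum and the
  infimum to have their usual meaning.\<close>

definition worst_case_error ::
  "(real \<Rightarrow> complex) set \<Rightarrow> nat \<Rightarrow> int \<Rightarrow> ((real \<Rightarrow> complex) \<Rightarrow> complex) \<Rightarrow> ereal" where
  "worst_case_error F s k A =
     (SUP f\<in>{f \<in> F. sobolev_norm s f \<le> 1}. ereal (cmod (osc_integral k f - A f)))"

definition min_error :: "nat \<Rightarrow> int \<Rightarrow> nat \<Rightarrow> ereal" where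
  "min_error n k s = (INF A\<in>algorithms n s. worst_case_error (sobolev s) s k A)"

definition min_error_periodic :: "nat \<Rightarrow> int \<Rightarrow> nat \<Rightarrow> ereal" where
  "min_error_periodic n k s =
     (INF A\<in>algorithms n s. worst_case_error (periodic_sobolev s) s k A)"

end

theory Submission
  imports Defs
begin

text \<open>The lower bound rests on a fooling function. Cut \<open>[0,1]\<close> into \<open>M = 4 (n + |k|)\<close> cells. At most
  \<open>n\<close> of them contain a node; on each of the others place a smooth bump of width \<open>1/M\<close>, multiplied
  by the phase that \<open>e\<^sup>2\<^sup>\<pi>\<^sup>i\<^sup>k\<^sup>x\<close> has at the centre of the cell. All the data of
  this function vanish, so the algorithm returns zero. Since the wave turns by at most an eighth of
  its period over half a cell, the bumps do not cancel in the oscillatory integral, which is bounded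
  below by a constant, while
  the \<open>s\<close>-th derivative is of size \<open>M\<^sup>s\<close>. Normalizing gives \<open>c / (n + |k|)\<^sup>s\<close>
  (\<open>fooling_function_exists\<close>). The function is periodic, so the bound holds for the periodic
  problem, and the supremum over the larger space is at least as large.

  For the upper bound, \<open>2 s\<close> pieces of data, namely the derivatives at both end points, are spent on
  making the function periodic: subtracting the combination of the Bernoulli polynomials
  \<open>B\<^sub>1, \<dots>, B\<^sub>s\<close> that has the same jumps as \<open>f\<close> leaves a periodic function \<open>g\<close> whose
  top derivative is the top derivative of \<open>f\<close> minus its mean, hence no larger in \<open>L\<^sub>2\<close>
  (\<open>periodized_top_norm_le\<close>). The polynomials are treated exactly. As \<open>g\<close> is sampled at the points
  \<open>0, 1/m, \<dots>, (m-1)/m\<close> and its value at 0 is already known, the budget allows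
  \<open>m = n - 2 s + 1\<close>. If \<open>m \<le> 2 |k|\<close>, the oscillatory integral of \<open>g\<close> is
  approximated by zero: \<open>s\<close> integrations by parts bound it by \<open>(2 \<pi> |k|)\<^sup>-\<^sup>s\<close>
  (\<open>periodic_chain_integral_bound\<close>). Otherwise the rectangle rule is applied to
  \<open>g(x) e\<^sup>-\<^sup>2\<^sup>\<pi>\<^sup>i\<^sup>k\<^sup>x\<close>. Its error only sees the frequencies \<open>k + h m\<close> with \<open>h \<noteq> 0\<close>, which are at
  least \<open>m - |k|\<close> in modulus, and it is at most \<open>2 (2 \<pi> (m - |k|))\<^sup>-\<^sup>s\<close>
  (\<open>periodic_chain_aliasing_bound\<close>). In both cases the relevant frequency is at
  least \<open>(m + |k|) / 3\<close>, which is where the factor \<open>3 / (2 \<pi>)\<close> comes from.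

  The aliasing bound is obtained without Fourier series. Averaging \<open>g(x) e\<^sup>-\<^sup>2\<^sup>\<pi>\<^sup>i\<^sup>k\<^sup>x\<close> over the cells of
  the grid turns the error into \<open>\<integral>V - V(0)\<close> for one periodic function \<open>V\<close>, and multiplication by the
  frequencies \<open>k + h m\<close> into the differential operator \<open>V \<mapsto> m V' + 2 \<pi> i k V\<close>. On periodic functions
  of mean zero the Wirtinger inequality \<open>2 \<pi> \<parallel>V\<parallel> \<le> \<parallel>V'\<parallel>\<close> bounds this operator
  below by \<open>2 \<pi> (m - |k|)\<close>. Its constant is raised to the power \<open>s\<close> and therefore has to be sharp; it
  comes from the corresponding statement for finite cyclic sequences, where the discrete Fourier
  transform diagonalizes the difference operator, by refining the grid (\<open>Wirtinger\<close>).\<close>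


section \<open>Square-integrable functions\<close>

text \<open>Measurability is kept separate because the existence of the second integral, a gauge integral,
  says nothing about \<open>u\<close> itself.\<close>

definition L2_on :: "real set \<Rightarrow> (real \<Rightarrow> complex) \<Rightarrow> bool" where
  "L2_on S u \<longleftrightarrow> u \<in> borel_measurable (lebesgue_on S) \<and> (\<lambda>x. (cmod (u x))\<^sup>2) integrable_on S"

definition L2_norm :: "real set \<Rightarrow> (real \<Rightarrow> complex) \<Rightarrow> real" where
  "L2_norm S u = sqrt (integral S (\<lambda>x. (cmod (u x))\<^sup>2))"

lemma L2_norm_nonneg [simp]: "0 \<le> L2_norm S u"
proof (cases "(\<lambda>x. (cmod (u x))\<^sup>2) integrable_on S")
  case True
  then show ?thesis
    unfolding L2_norm_def by (simp add: integral_nonneg)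
next
  case False
  then show ?thesis
    by (simp add: L2_norm_def not_integrable_integral)
qed

lemma L2_norm_sq: "(L2_norm S u)\<^sup>2 = integral S (\<lambda>x. (cmod (u x))\<^sup>2)"
proof (cases "(\<lambda>x. (cmod (u x))\<^sup>2) integrable_on S")
  case True
  then show ?thesis
    unfolding L2_norm_def by (simp add: integral_nonneg)
next
  case False
  then show ?thesis
    by (simp add: L2_norm_def not_integrable_integral)
qed

lemma L2_on_cong: "(\<And>x. x \<in> S \<Longrightarrow> u x = v x) \<Longrightarrow> L2_on S u \<longleftrightarrow> L2_on S v"
  unfolding L2_on_def
  by (intro conj_cong measurable_cong integrable_cong) auto

lemma L2_on_mult_absolutely_integrable:
  assumes S: "S \<in> sets lebesgue" and u: "L2_on S u" and v: "L2_on S v"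
  shows "(\<lambda>x. u x * v x) absolutely_integrable_on S"
proof (rule measurable_bounded_by_integrable_imp_absolutely_integrable)
  show "(\<lambda>x. u x * v x) \<in> borel_measurable (lebesgue_on S)"
    using u v by (auto simp: L2_on_def)
  show "(\<lambda>x. (cmod (u x))\<^sup>2 + (cmod (v x))\<^sup>2) integrable_on S"
    using u v by (intro integrable_add) (auto simp: L2_on_def)
  show "cmod (u x * v x) \<le> (cmod (u x))\<^sup>2 + (cmod (v x))\<^sup>2" for x
  proof -
    have "2 * (cmod (u x) * cmod (v x)) \<le> (cmod (u x))\<^sup>2 + (cmod (v x))\<^sup>2"
      using sum_squares_bound[of "cmod (u x)" "cmod (v x)"] by (simp add: mult.assoc)
    moreover have "0 \<le> cmod (u x) * cmod (v x)"
      by simp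
    ultimately show ?thesis
      unfolding norm_mult by linarith
  qed
qed (use S in auto)

lemma L2_on_cmult:
  assumes "L2_on S u" shows "L2_on S (\<lambda>x. c * u x)"
  using assms by (auto simp: L2_on_def norm_mult power_mult_distrib intro: integrable_on_mult_right)

lemma L2_on_add:
  assumes S: "S \<in> sets lebesgue" and u: "L2_on S u" and v: "L2_on S v"
  shows "L2_on S (\<lambda>x. u x + v x)"
proof -
  have m: "(\<lambda>x. u x + v x) \<in> borel_measurable (lebesgue_on S)"
    using u v by (auto simp: L2_on_def)
  have m2: "(\<lambda>x. (cmod (u x + v x))\<^sup>2) \<in> borel_measurable (lebesgue_on S)"
    using m by measurable
  have "(\<lambda>x. (cmod (u x + v x))\<^sup>2) integrable_on S"
  proof (rule measurable_bounded_by_integrable_imp_integrable[OF m2 _ _ S])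
    show "(\<lambda>x. 2 * (cmod (u x))\<^sup>2 + 2 * (cmod (v x))\<^sup>2) integrable_on S"
      using u v by (intro integrable_add integrable_on_cmult_left) (auto simp: L2_on_def)
    show "norm ((cmod (u x + v x))\<^sup>2) \<le> 2 * (cmod (u x))\<^sup>2 + 2 * (cmod (v x))\<^sup>2" for x
    proof -
      have "(cmod (u x + v x))\<^sup>2 \<le> (cmod (u x) + cmod (v x))\<^sup>2"
        by (intro power_mono norm_triangle_ineq) auto
      also have "\<dots> \<le> 2 * (cmod (u x))\<^sup>2 + 2 * (cmod (v x))\<^sup>2"
        using sum_squares_bound[of "cmod (u x)" "cmod (v x)"] by (simp add: power2_sum)
      finally show ?thesis by simp
    qed
  qed
  with m show ?thesis by (simp add: L2_on_def)
qed

lemma L2_on_diff: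
  assumes S: "S \<in> sets lebesgue" and u: "L2_on S u" and v: "L2_on S v"
  shows "L2_on S (\<lambda>x. u x - v x)"
  using L2_on_add[OF S u L2_on_cmult[OF v, of "-1"]] by simp

lemma L2_on_zero: "L2_on S (\<lambda>x. 0)"
  by (simp add: L2_on_def integrable_0)

lemma L2_on_sum:
  assumes "S \<in> sets lebesgue" "\<And>i. i \<in> I \<Longrightarrow> L2_on S (u i)"
  shows "L2_on S (\<lambda>x. \<Sum>i\<in>I. u i x)"
  using assms(2)
  by (induction I rule: infinite_finite_induct)
     (auto intro: L2_on_zero L2_on_add[OF assms(1)])

lemma L2_on_continuous:
  fixes a b :: real
  assumes "continuous_on {a..b} u" shows "L2_on {a..b} u"
proof -
  have "(\<lambda>x. (cmod (u x))\<^sup>2) integrable_on {a..b}"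
    by (intro integrable_continuous_interval continuous_intros assms)
  moreover have "u \<in> borel_measurable (lebesgue_on {a..b})"
    using assms by (simp add: continuous_imp_measurable_on_sets_lebesgue)
  ultimately show ?thesis by (simp add: L2_on_def)
qed

lemma L2_on_subinterval:
  assumes "L2_on {a..b} u" "{c..d} \<subseteq> {a..b}"
  shows "L2_on {c..d::real} u"
proof -
  have "u \<in> borel_measurable (lebesgue_on {c..d})"
    using measurable_restrict_mono assms unfolding L2_on_def by blast
  moreover have "(\<lambda>x. (cmod (u x))\<^sup>2) integrable_on {c..d}"
    using integrable_on_subinterval[OF _ assms(2)] assms(1) unfolding L2_on_def by blast
  ultimately show ?thesis by (simp add: L2_on_def)
qed

lemma L2_on_mult_continuous:
  fixes a b :: real
  assumes u: "L2_on {a..b} u" and c: "continuous_on {a..b} c"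
  shows "L2_on {a..b} (\<lambda>x. u x * c x)"
proof -
  have m: "c \<in> borel_measurable (lebesgue_on {a..b})"
    using c by (simp add: continuous_imp_measurable_on_sets_lebesgue)
  have m1: "(\<lambda>x. u x * c x) \<in> borel_measurable (lebesgue_on {a..b})"
    using u m by (auto simp: L2_on_def)
  then have m2: "(\<lambda>x. (cmod (u x * c x))\<^sup>2) \<in> borel_measurable (lebesgue_on {a..b})"
    by measurable
  obtain B where B: "\<And>x. x \<in> {a..b} \<Longrightarrow> cmod (c x) \<le> B"
    using compact_imp_bounded[OF compact_continuous_image[OF c compact_Icc]] 
    unfolding bounded_iff by blast
  have "(\<lambda>x. (cmod (u x * c x))\<^sup>2) integrable_on {a..b}"
  proof (rule measurable_bounded_by_integrable_imp_integrable[OF m2])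
    show "(\<lambda>x. B\<^sup>2 * (cmod (u x))\<^sup>2) integrable_on {a..b}"
      using u by (intro integrable_on_mult_right) (auto simp: L2_on_def)
    show "norm ((cmod (u x * c x))\<^sup>2) \<le> B\<^sup>2 * (cmod (u x))\<^sup>2" if "x \<in> {a..b}" for x
      using power_mono[OF B[OF that], of 2]
      by (auto simp: norm_mult power_mult_distrib mult.commute intro!: mult_mono)
  qed auto
  with m1 show ?thesis by (simp add: L2_on_def)
qed

lemma L2_on_absolutely_integrable:
  fixes a b :: real
  assumes "L2_on {a..b} u"
  shows "u absolutely_integrable_on {a..b}"
  using L2_on_mult_absolutely_integrable[OF _ assms L2_on_continuous[of a b "\<lambda>_. 1"]]
  by simp

text \<open>The integral of \<open>(|u| - t |v|)\<^sup>2\<close> is a quadratic polynomial in \<open>t\<close> without negative values.\<close>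

lemma L2_Cauchy_Schwarz_norm:
  assumes S: "S \<in> sets lebesgue" and u: "L2_on S u" and v: "L2_on S v"
  shows "integral S (\<lambda>x. cmod (u x) * cmod (v x)) \<le> L2_norm S u * L2_norm S v"
proof -
  define p q r where "p = integral S (\<lambda>x. (cmod (u x))\<^sup>2)" and "q = integral S (\<lambda>x. (cmod (v x))\<^sup>2)"
    and "r = integral S (\<lambda>x. cmod (u x) * cmod (v x))"
  have uv: "(\<lambda>x. cmod (u x) * cmod (v x)) integrable_on S"
    using L2_on_mult_absolutely_integrable[OF S u v]
    by (auto simp: absolutely_integrable_on_def norm_mult)
  have u2: "(\<lambda>x. (cmod (u x))\<^sup>2) integrable_on S" and v2: "(\<lambda>x. (cmod (v x))\<^sup>2) integrable_on S"
    using u v by (auto simp: L2_on_def)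
  have r0: "0 \<le> r" and p0: "0 \<le> p" and q0: "0 \<le> q"
    unfolding r_def p_def q_def using uv u2 v2 by (auto intro!: integral_nonneg)
  have quad: "0 \<le> p - 2 * t * r + t\<^sup>2 * q" for t
  proof -
    have "((\<lambda>x. (cmod (u x))\<^sup>2 - 2 * t * (cmod (u x) * cmod (v x)) + t\<^sup>2 * (cmod (v x))\<^sup>2)
            has_integral (p - 2 * t * r + t\<^sup>2 * q)) S"
      unfolding p_def q_def r_def
      by (intro has_integral_add has_integral_diff has_integral_mult_right integrable_integral u2 v2 uv)
    moreover have "(cmod (u x))\<^sup>2 - 2 * t * (cmod (u x) * cmod (v x)) + t\<^sup>2 * (cmod (v x))\<^sup>2
        = (cmod (u x) - t * cmod (v x))\<^sup>2" for x
      by (simp add: power2_eq_square algebra_simps)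
    ultimately show ?thesis
      by (metis (no_types, lifting) has_integral_nonneg zero_le_power2)
  qed
  have "r\<^sup>2 \<le> p * q"
  proof (cases "q = 0")
    case True
    have "r = 0"
    proof (rule ccontr)
      assume "r \<noteq> 0"
      then have "2 * ((p + 1) / r) * r = 2 * p + 2"
        by simp
      then show False
        \<comment> \<open>Without a quadratic term, a nonzero linear term would make the polynomial negative somewhere.\<close>
        using quad[of "(p + 1) / r"] True p0 by simp
    qed
    with p0 q0 show ?thesis by simp
  next
    case False
    with q0 have "q > 0" by simp
    \<comment> \<open>This is where the quadratic polynomial has its minimum.\<close>
    with quad[of "r / q"] show ?thesis
      by (simp add: field_simps power2_eq_square)
  qed
  then have "sqrt (r\<^sup>2) \<le> sqrt (p * q)"
    by (rule real_sqrt_le_mono)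
  with r0 show ?thesis
    unfolding L2_norm_def r_def p_def q_def by (simp add: real_sqrt_mult)
qed

lemma L2_Cauchy_Schwarz:
  assumes S: "S \<in> sets lebesgue" and u: "L2_on S u" and v: "L2_on S v"
  shows "cmod (integral S (\<lambda>x. u x * v x)) \<le> L2_norm S u * L2_norm S v"
proof -
  note ai = L2_on_mult_absolutely_integrable[OF S u v]
  have "cmod (integral S (\<lambda>x. u x * v x)) \<le> integral S (\<lambda>x. cmod (u x) * cmod (v x))"
    using ai by (intro integral_norm_bound_integral) (auto simp: absolutely_integrable_on_def norm_mult)
  with L2_Cauchy_Schwarz_norm[OF S u v] show ?thesis by simp
qed

text \<open>The square of the sum is at most \<open>|u|\<^sup>2 + |v|\<^sup>2 + 2 |u| |v|\<close> pointwise; the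
  Cauchy-Schwarz inequality handles the integral of the last term.\<close>

lemma L2_norm_triangle:
  assumes S: "S \<in> sets lebesgue" and u: "L2_on S u" and v: "L2_on S v"
  shows "L2_norm S (\<lambda>x. u x + v x) \<le> L2_norm S u + L2_norm S v"
proof (rule power2_le_imp_le)
  have uv: "(\<lambda>x. cmod (u x) * cmod (v x)) integrable_on S"
    using L2_on_mult_absolutely_integrable[OF S u v]
    by (auto simp: absolutely_integrable_on_def norm_mult)
  have u2: "(\<lambda>x. (cmod (u x))\<^sup>2) integrable_on S" and v2: "(\<lambda>x. (cmod (v x))\<^sup>2) integrable_on S"
    using u v by (auto simp: L2_on_def)
  have s2: "(\<lambda>x. (cmod (u x + v x))\<^sup>2) integrable_on S"
    using L2_on_add[OF S u v] by (auto simp: L2_on_def)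
  have i: "((\<lambda>x. (cmod (u x))\<^sup>2 + (cmod (v x))\<^sup>2 + 2 * (cmod (u x) * cmod (v x))) has_integral
      ((L2_norm S u)\<^sup>2 + (L2_norm S v)\<^sup>2 + 2 * integral S (\<lambda>x. cmod (u x) * cmod (v x)))) S"
    unfolding L2_norm_sq
    by (intro has_integral_add has_integral_mult_right integrable_integral u2 v2 uv)
  have "(L2_norm S (\<lambda>x. u x + v x))\<^sup>2
      \<le> (L2_norm S u)\<^sup>2 + (L2_norm S v)\<^sup>2 + 2 * integral S (\<lambda>x. cmod (u x) * cmod (v x))"
    unfolding L2_norm_sq[of S "\<lambda>x. u x + v x"]
  proof (rule has_integral_le[OF integrable_integral[OF s2] i])
    fix x
    have "(cmod (u x + v x))\<^sup>2 \<le> (cmod (u x) + cmod (v x))\<^sup>2"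
      by (intro power_mono norm_triangle_ineq) auto
    then show "(cmod (u x + v x))\<^sup>2 \<le> (cmod (u x))\<^sup>2 + (cmod (v x))\<^sup>2 + 2 * (cmod (u x) * cmod (v x))"
      by (simp add: power2_sum mult.assoc)
  qed
  also have "\<dots> \<le> (L2_norm S u + L2_norm S v)\<^sup>2"
    using L2_Cauchy_Schwarz_norm[OF S u v] by (simp add: power2_sum)
  finally show "(L2_norm S (\<lambda>x. u x + v x))\<^sup>2 \<le> (L2_norm S u + L2_norm S v)\<^sup>2" .
qed simp

lemma L2_norm_cmult: "L2_norm S (\<lambda>x. c * u x) = cmod c * L2_norm S u"
  unfolding L2_norm_def by (simp add: norm_mult power_mult_distrib real_sqrt_mult)

text \<open>The Cauchy-Schwarz inequality with the constant function 1 as second factor.\<close>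

lemma cmod_integral_square_le:
  fixes a b :: real
  assumes u: "L2_on {a..b} u" and ab: "a \<le> b"
  shows "(cmod (integral {a..b} u))\<^sup>2 \<le> (b - a) * integral {a..b} (\<lambda>x. (cmod (u x))\<^sup>2)"
proof -
  have "cmod (integral {a..b} (\<lambda>x. u x * 1)) \<le> L2_norm {a..b} u * L2_norm {a..b} (\<lambda>_. 1)"
    by (intro L2_Cauchy_Schwarz u L2_on_continuous) auto
  then have "(cmod (integral {a..b} u))\<^sup>2 \<le> (L2_norm {a..b} u * L2_norm {a..b} (\<lambda>_. 1))\<^sup>2"
    by (intro power_mono) auto
  then show ?thesis
    using ab by (simp add: power_mult_distrib L2_norm_sq mult.commute)
qed

section \<open>Weak derivatives in \<open>L\<^sub>2\<close>\<close>

text \<open>The relation ``\<open>u'\<close> is the weak derivative of \<open>u\<close> and belongs to \<open>L\<^sub>2\<close>''. Stating it by increments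
  treats the derivatives below the top one, which exist everywhere, and the top one, which exists
  almost everywhere, on the same footing, and it survives affine substitutions without any
  discussion of differentiability.\<close>

definition L2_primitive :: "(real \<Rightarrow> complex) \<Rightarrow> (real \<Rightarrow> complex) \<Rightarrow> bool" where
  "L2_primitive u u' \<longleftrightarrow> L2_on {0..1} u' \<and>
     (\<forall>a b. 0 \<le> a \<longrightarrow> a \<le> b \<longrightarrow> b \<le> 1 \<longrightarrow> (u' has_integral u b - u a) {a..b})"

lemma L2_primitiveD:
  assumes "L2_primitive u u'" "0 \<le> a" "a \<le> b" "b \<le> 1"
  shows "(u' has_integral u b - u a) {a..b}"
  using assms by (auto simp: L2_primitive_def)

lemma L2_primitive_L2: "L2_primitive u u' \<Longrightarrow> L2_on {0..1} u'"
  by (auto simp: L2_primitive_def)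

lemma L2_primitive_continuous:
  assumes "L2_primitive u u'"
  shows "continuous_on {0..1} u"
proof -
  have i: "u' integrable_on {0..1}"
    using L2_primitiveD[OF assms, of 0 1] by (auto simp: integrable_on_def)
  have "continuous_on {0..1} (\<lambda>x. u 0 + integral {0..x} u')"
    by (intro continuous_intros indefinite_integral_continuous_1 i)
  then show ?thesis
  proof (rule continuous_on_eq)
    show "u 0 + integral {0..x} u' = u x" if "x \<in> {0..1}" for x
      using integral_unique[OF L2_primitiveD[OF assms, of 0 x]] that by auto
  qed
qed

lemma L2_primitive_cong:
  assumes "L2_primitive u u'" "\<And>x. x \<in> {0..1} \<Longrightarrow> v x = u x" "\<And>x. x \<in> {0..1} \<Longrightarrow> v' x = u' x"
  shows "L2_primitive v v'"
  unfolding L2_primitive_def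
proof (intro conjI allI impI)
  show "L2_on {0..1} v'"
    using L2_on_cong[of "{0..1}" v' u'] assms by (auto simp: L2_primitive_def)
  show "(v' has_integral v b - v a) {a..b}" if "0 \<le> a" "a \<le> b" "b \<le> 1" for a b
    using has_integral_cong[of "{a..b}" v' u'] L2_primitiveD[OF assms(1) that] assms(2,3) that by auto
qed

lemma L2_primitive_const: "L2_primitive (\<lambda>_. c) (\<lambda>_. 0)"
  by (simp add: L2_primitive_def L2_on_zero)

lemma L2_primitive_add:
  assumes "L2_primitive u u'" "L2_primitive v v'"
  shows "L2_primitive (\<lambda>x. u x + v x) (\<lambda>x. u' x + v' x)"
  unfolding L2_primitive_def
proof (intro conjI allI impI)
  show "L2_on {0..1} (\<lambda>x. u' x + v' x)"
    using assms by (intro L2_on_add) (auto simp: L2_primitive_def)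
  show "((\<lambda>x. u' x + v' x) has_integral u b + v b - (u a + v a)) {a..b}"
    if "0 \<le> a" "a \<le> b" "b \<le> 1" for a b
    using has_integral_add[OF L2_primitiveD[OF assms(1) that] L2_primitiveD[OF assms(2) that]]
    by (simp add: algebra_simps)
qed

lemma L2_primitive_cmult:
  assumes "L2_primitive u u'"
  shows "L2_primitive (\<lambda>x. c * u x) (\<lambda>x. c * u' x)"
  unfolding L2_primitive_def
proof (intro conjI allI impI)
  show "L2_on {0..1} (\<lambda>x. c * u' x)"
    using assms by (intro L2_on_cmult) (auto simp: L2_primitive_def)
  show "((\<lambda>x. c * u' x) has_integral c * u b - c * u a) {a..b}"
    if "0 \<le> a" "a \<le> b" "b \<le> 1" for a b
    using has_integral_mult_right[OF L2_primitiveD[OF assms(1) that], of c]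
    by (simp add: algebra_simps)
qed

lemma L2_primitive_diff:
  assumes "L2_primitive u u'" "L2_primitive v v'"
  shows "L2_primitive (\<lambda>x. u x - v x) (\<lambda>x. u' x - v' x)"
  using L2_primitive_add[OF assms(1) L2_primitive_cmult[OF assms(2), of "-1"]] by simp

lemma L2_primitive_sum:
  assumes "\<And>i. i \<in> I \<Longrightarrow> L2_primitive (u i) (u' i)"
  shows "L2_primitive (\<lambda>x. \<Sum>i\<in>I. u i x) (\<lambda>x. \<Sum>i\<in>I. u' i x)"
  using assms
  by (induction I rule: infinite_finite_induct)
     (auto intro: L2_primitive_const[of 0] L2_primitive_add)

lemma L2_primitive_C1:
  assumes d: "\<And>x. x \<in> {0..1} \<Longrightarrow> (u has_vector_derivative u' x) (at x within {0..1})"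
    and c: "continuous_on {0..1} u'"
  shows "L2_primitive u u'"
  unfolding L2_primitive_def
proof (intro conjI allI impI)
  show "L2_on {0..1} u'"
    by (rule L2_on_continuous[OF c])
  show "(u' has_integral u b - u a) {a..b}" if "0 \<le> a" "a \<le> b" "b \<le> 1" for a b
    using that by (intro fundamental_theorem_of_calculus has_vector_derivative_within_subset[OF d]) auto
qed

lemma L2_primitive_increment:
  assumes p: "L2_primitive u u'" and ab: "0 \<le> a" "a \<le> b" "b \<le> 1"
  shows "(cmod (u b - u a))\<^sup>2 \<le> (b - a) * integral {a..b} (\<lambda>x. (cmod (u' x))\<^sup>2)"
proof -
  have "L2_on {a..b} u'"
    using L2_on_subinterval[OF L2_primitive_L2[OF p]] ab by auto
  from cmod_integral_square_le[OF this ab(2)] show ?thesis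
    using integral_unique[OF L2_primitiveD[OF p ab]] by simp
qed

lemma integral_uniform_partition:
  fixes f :: "real \<Rightarrow> 'a::banach"
  assumes f: "f integrable_on {a..b}" and ab: "a \<le> b" and N: "N > 0"
  defines "x \<equiv> \<lambda>j::nat. a + (b - a) * (j / N)"
  shows "integral {a..b} f = (\<Sum>j<N. integral {x j..x (Suc j)} f)"
proof -
  have xmono: "x i \<le> x j" if "i \<le> j" for i j
    unfolding x_def using that ab N
    by (intro add_left_mono mult_left_mono divide_right_mono) auto
  have x0: "x 0 = a" and xN: "x N = b"
    using N by (auto simp: x_def)
  have "integral {a..x n} f = (\<Sum>j<n. integral {x j..x (Suc j)} f)" if "n \<le> N" for n
    using that
  proof (induction n)
    case 0
    then show ?case by (simp add: x0)
  next
    case (Suc n)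
    have "integral {a..x (Suc n)} f = integral {a..x n} f + integral {x n..x (Suc n)} f"
    proof (rule Henstock_Kurzweil_Integration.integral_combine[symmetric])
      show "a \<le> x n" using xmono[of 0 n] x0 by simp
      show "x n \<le> x (Suc n)" using xmono by simp
      show "f integrable_on {a..x (Suc n)}"
        using xmono[OF Suc.prems] xN by (intro integrable_subinterval_real[OF f]) auto
    qed
    with Suc show ?case by simp
  qed
  from this[of N] show ?thesis by (simp add: xN)
qed

text \<open>On a fine partition the increments add up to at most \<open>\<epsilon>\<close> times the integral of \<open>G\<close> over the
  whole interval, and \<open>\<epsilon>\<close> is arbitrary.\<close>

lemma eq_of_small_increments:
  fixes \<Psi> :: "real \<Rightarrow> complex"
  assumes G: "G integrable_on {a..b}" and ab: "a \<le> b"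
    and small: "\<And>\<epsilon>. \<epsilon> > 0 \<Longrightarrow> \<exists>\<delta>>0. \<forall>c d. a \<le> c \<longrightarrow> c \<le> d \<longrightarrow> d \<le> b \<longrightarrow> d - c < \<delta> \<longrightarrow>
      cmod (\<Psi> d - \<Psi> c) \<le> \<epsilon> * integral {c..d} G"
  shows "\<Psi> b = \<Psi> a"
proof -
  have "cmod (\<Psi> b - \<Psi> a) \<le> \<epsilon> * integral {a..b} G" if e: "\<epsilon> > 0" for \<epsilon>
  proof -
    obtain \<delta> where \<delta>: "\<delta> > 0" and d: "\<And>c d. \<lbrakk>a \<le> c; c \<le> d; d \<le> b; d - c < \<delta>\<rbrakk> \<Longrightarrow>
        cmod (\<Psi> d - \<Psi> c) \<le> \<epsilon> * integral {c..d} G"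
      using small[OF e] by blast
    obtain N :: nat where N: "(b - a + 1) / \<delta> < N"
      using reals_Archimedean2 by blast
    have "0 < (b - a + 1) / \<delta>"
      using \<delta> ab by simp
    with N have N0: "N > 0"
      by linarith
    define x where "x j = a + (b - a) * (real j / real N)" for j :: nat
    have xmono: "x i \<le> x j" if "i \<le> j" for i j
      unfolding x_def using that ab N0
      by (intro add_left_mono mult_left_mono divide_right_mono) auto
    have x0: "x 0 = a" and xN: "x N = b"
      using N0 by (auto simp: x_def)
    have step: "x (Suc j) - x j < \<delta>" for j
    proof -
      have "x (Suc j) - x j = (b - a) / N"
        using N0 by (simp add: x_def field_simps)
      also have "\<dots> < \<delta>"
        using N N0 \<delta> by (simp add: field_simps)
      finally show ?thesis .
    qed
    have "\<Psi> b - \<Psi> a = (\<Sum>j<N. \<Psi> (x (Suc j)) - \<Psi> (x j))"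
      using sum_lessThan_telescope[of "\<lambda>j. \<Psi> (x j)" N] by (simp add: x0 xN)
    then have "cmod (\<Psi> b - \<Psi> a) \<le> (\<Sum>j<N. cmod (\<Psi> (x (Suc j)) - \<Psi> (x j)))"
      by (simp add: norm_sum)
    also have "\<dots> \<le> (\<Sum>j<N. \<epsilon> * integral {x j..x (Suc j)} G)"
    proof (rule sum_mono)
      fix j assume "j \<in> {..<N}"
      then have j: "Suc j \<le> N" by simp
      show "cmod (\<Psi> (x (Suc j)) - \<Psi> (x j)) \<le> \<epsilon> * integral {x j..x (Suc j)} G"
        using d[of "x j" "x (Suc j)"] xmono[of 0 j] xmono[of j "Suc j"] xmono[OF j] x0 xN step by auto
    qed
    also have "\<dots> = \<epsilon> * integral {a..b} G"
      using integral_uniform_partition[OF G ab N0] by (simp add: x_def sum_distrib_left)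
    finally show ?thesis .
  qed
  note bound = this
  have "cmod (\<Psi> b - \<Psi> a) \<le> 0"
  proof (rule field_le_epsilon)
    fix e :: real assume e: "e > 0"
    define I where "I = \<bar>integral {a..b} G\<bar> + 1"
    have I: "I > 0" by (simp add: I_def)
    have "cmod (\<Psi> b - \<Psi> a) \<le> e / I * integral {a..b} G"
      using bound[of "e / I"] e I by simp
    also have "\<dots> \<le> e / I * I"
      using e I by (intro mult_left_mono) (auto simp: I_def)
    finally show "cmod (\<Psi> b - \<Psi> a) \<le> 0 + e"
      using I by simp
  qed
  then show ?thesis by simp
qed

text \<open>The product rule, and with it integration by parts, for one weak and one classical derivative. As
  \<open>u'\<close> is not a pointwise derivative, the two sides are compared on short intervals, where \<open>u\<close> and
  \<open>\<phi>\<close> are almost constant.\<close>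

lemma L2_primitive_mult:
  assumes p: "L2_primitive u u'"
    and d: "\<And>x. x \<in> {0..1} \<Longrightarrow> (\<phi> has_vector_derivative \<phi>' x) (at x within {0..1})"
    and c': "continuous_on {0..1} \<phi>'"
  shows "L2_primitive (\<lambda>x. u x * \<phi> x) (\<lambda>x. u' x * \<phi> x + u x * \<phi>' x)"
proof -
  define F where "F x = u' x * \<phi> x + u x * \<phi>' x" for x
  have c: "continuous_on {0..1} \<phi>"
    using L2_primitive_continuous[OF L2_primitive_C1[OF d c']] .
  have cu: "continuous_on {0..1} u"
    using L2_primitive_continuous[OF p] .
  have L2F: "L2_on {0..1} F"
    unfolding F_def
    by (intro L2_on_add L2_on_mult_continuous L2_primitive_L2[OF p] c L2_on_continuous
        continuous_intros cu c') auto
  have sub: "f integrable_on {a..b}" if "f integrable_on {0..1}" "0 \<le> a" "b \<le> 1" 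
    for f :: "real \<Rightarrow> 'z::banach" and a b :: real
    using that by (intro integrable_subinterval_real[OF that(1)]) auto
  have Fint: "F integrable_on {0..1}" and uint: "u' integrable_on {0..1}" 
    and unint: "(\<lambda>x. cmod (u' x)) integrable_on {0..1}"
    using L2_on_absolutely_integrable[OF L2F] L2_on_absolutely_integrable[OF L2_primitive_L2[OF p]]
    by (auto simp: absolutely_integrable_on_def)
  obtain K where K: "\<And>x. x \<in> {0..1} \<Longrightarrow> cmod (\<phi>' x) \<le> K"
    using compact_imp_bounded[OF compact_continuous_image[OF c' compact_Icc]]
    unfolding bounded_iff by blast
  have K0: "K \<ge> 0"
    using order_trans[OF norm_ge_zero K[of 0]] by simp
  define G where "G x = cmod (u' x) + K" for x
  have Gint: "G integrable_on {0..1}"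
    unfolding G_def by (intro integrable_add unint) auto
  define \<Psi> where "\<Psi> x = u x * \<phi> x - integral {0..x} F" for x
  have main: "\<Psi> b = \<Psi> a" if ab: "0 \<le> a" "a \<le> b" "b \<le> 1" for a b
  proof (rule eq_of_small_increments[OF sub[OF Gint ab(1,3)] ab(2)])
    fix \<epsilon> :: real assume e: "\<epsilon> > 0"
    obtain \<delta>1 where \<delta>1: "\<delta>1 > 0" "\<And>x y. \<lbrakk>x \<in> {0..1}; y \<in> {0..1}; dist y x < \<delta>1\<rbrakk> \<Longrightarrow> dist (\<phi> y) (\<phi> x) < \<epsilon>"
      using compact_uniformly_continuous[OF c compact_Icc] e unfolding uniformly_continuous_on_def by metis
    obtain \<delta>2 where \<delta>2: "\<delta>2 > 0" "\<And>x y. \<lbrakk>x \<in> {0..1}; y \<in> {0..1}; dist y x < \<delta>2\<rbrakk> \<Longrightarrow> dist (u y) (u x) < \<epsilon>"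
      using compact_uniformly_continuous[OF cu compact_Icc] e unfolding uniformly_continuous_on_def by metis
    show "\<exists>\<delta>>0. \<forall>c d. a \<le> c \<longrightarrow> c \<le> d \<longrightarrow> d \<le> b \<longrightarrow> d - c < \<delta> \<longrightarrow>
      cmod (\<Psi> d - \<Psi> c) \<le> \<epsilon> * integral {c..d} G"
    proof (intro exI[of _ "min \<delta>1 \<delta>2"] conjI allI impI)
      show "0 < min \<delta>1 \<delta>2" using \<delta>1 \<delta>2 by simp
      fix l r assume lr: "a \<le> l" "l \<le> r" "r \<le> b" and small: "r - l < min \<delta>1 \<delta>2"
      have l: "0 \<le> l" and r: "r \<le> 1" using lr ab by auto
      have "integral {0..r} F = integral {0..l} F + integral {l..r} F"
        using l r lr(2) by (intro Henstock_Kurzweil_Integration.integral_combine[symmetric] sub[OF Fint]) auto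
      then have "\<Psi> r - \<Psi> l = (u r - u l) * \<phi> l + u r * (\<phi> r - \<phi> l) - integral {l..r} F"
        by (simp add: \<Psi>_def algebra_simps)
      moreover have "((\<lambda>x. u' x * \<phi> l + u r * \<phi>' x - F x) has_integral
           (u r - u l) * \<phi> l + u r * (\<phi> r - \<phi> l) - integral {l..r} F) {l..r}"
        by (intro has_integral_add has_integral_diff has_integral_mult_left has_integral_mult_right
            L2_primitiveD[OF p l lr(2) r] L2_primitiveD[OF L2_primitive_C1[OF d c'] l lr(2) r]
            integrable_integral sub[OF Fint l r])
      ultimately have hi: "((\<lambda>x. u' x * \<phi> l + u r * \<phi>' x - F x) has_integral \<Psi> r - \<Psi> l) {l..r}"
        by simp
      have "cmod (\<Psi> r - \<Psi> l) \<le> integral {l..r} (\<lambda>x. \<epsilon> * G x)"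
      proof (rule order_trans[OF _ integral_norm_bound_integral])
        show "(\<lambda>x. u' x * \<phi> l + u r * \<phi>' x - F x) integrable_on {l..r}"
          using hi by (auto simp: integrable_on_def)
        show "cmod (\<Psi> r - \<Psi> l) \<le> norm (integral {l..r} (\<lambda>x. u' x * \<phi> l + u r * \<phi>' x - F x))"
          using integral_unique[OF hi] by simp
        show "(\<lambda>x. \<epsilon> * G x) integrable_on {l..r}"
          by (intro integrable_on_mult_right sub[OF Gint l r])
        fix x assume x: "x \<in> {l..r}"
        have 1: "cmod (\<phi> l - \<phi> x) \<le> \<epsilon>"
          using \<delta>1(2)[of x l] x l r small by (auto simp: dist_norm dist_real_def)
        have 2: "cmod (u r - u x) \<le> \<epsilon>"
          using \<delta>2(2)[of x r] x l r small by (auto simp: dist_norm dist_real_def)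
        have "u' x * \<phi> l + u r * \<phi>' x - F x = u' x * (\<phi> l - \<phi> x) + (u r - u x) * \<phi>' x"
          by (simp add: F_def algebra_simps)
        then have "cmod (u' x * \<phi> l + u r * \<phi>' x - F x)
            \<le> cmod (u' x) * cmod (\<phi> l - \<phi> x) + cmod (u r - u x) * cmod (\<phi>' x)"
          using norm_triangle_ineq by (metis norm_mult)
        also have "\<dots> \<le> cmod (u' x) * \<epsilon> + \<epsilon> * K"
          using 1 2 K[of x] x l r e by (intro add_mono mult_mono) auto
        finally show "cmod (u' x * \<phi> l + u r * \<phi>' x - F x) \<le> \<epsilon> * G x"
          by (simp add: G_def algebra_simps)
      qed
      then show "cmod (\<Psi> r - \<Psi> l) \<le> \<epsilon> * integral {l..r} G"
        by simp
    qed
  qed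
  have "L2_primitive (\<lambda>x. u x * \<phi> x) F"
    unfolding L2_primitive_def
  proof (intro conjI L2F allI impI)
    fix a b :: real assume ab: "0 \<le> a" "a \<le> b" "b \<le> 1"
    have "integral {0..b} F = integral {0..a} F + integral {a..b} F"
      using ab by (intro Henstock_Kurzweil_Integration.integral_combine[symmetric] sub[OF Fint]) auto
    with main[OF ab] have "u b * \<phi> b - u a * \<phi> a = integral {a..b} F"
      by (simp add: \<Psi>_def algebra_simps)
    then show "(F has_integral u b * \<phi> b - u a * \<phi> a) {a..b}"
      using integrable_integral[OF sub[OF Fint ab(1,3)]] by simp
  qed
  then show ?thesis by (simp add: F_def[abs_def])
qed

section \<open>The fundamental theorem of calculus for absolutely continuous functions\<close>

lemma negligible_open_cover:
  fixes N :: "real set"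
  assumes N: "negligible N" and d: "\<delta> > 0"
  obtains U where "open U" "N \<subseteq> U" "emeasure lborel U < ennreal \<delta>"
proof -
  have Ns: "N \<in> sets lebesgue" and N0: "N \<in> null_sets lebesgue"
    using N by (auto simp: negligible_iff_null_sets)
  obtain U where U: "open U" "N \<subseteq> U" "emeasure lebesgue (U - N) < ennreal \<delta>"
    by (rule sets_lebesgue_outer_open[OF Ns d])
  have "emeasure lborel U = emeasure lebesgue U"
    using U(1) by simp
  also have "\<dots> = emeasure lebesgue (U - N)"
    using U(1) N0 by (intro emeasure_Diff_null_set[symmetric]) auto
  finally show thesis
    using that U by simp
qed

text \<open>The gauge decides between two kinds of tags. At a tag where the derivative exists, it makes
  the interval so short that the increment of \<open>f\<close> is almost linear. A tag in the null set \<open>N\<close> has its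
  interval inside an open set of measure less than \<open>\<delta>\<close>; these intervals do not overlap, so absolute
  continuity makes the sum of the increments of \<open>f\<close> over them small.\<close>

lemma abs_continuous_FTC:
  fixes f :: "real \<Rightarrow> complex"
  assumes AC: "abs_continuous_on S f" and S: "{a..b} \<subseteq> S" and ab: "a \<le> b" and N: "negligible N"
    and d: "\<And>x. x \<in> {a..b} - N \<Longrightarrow> (f has_vector_derivative f' x) (at x within {a..b})"
  shows "(f' has_integral f b - f a) {a..b}"
proof -
  \<comment> \<open>On the null set the derivative is arbitrary; the value zero removes those tags from the
    Riemann sums.\<close>
  define g where "g x = (if x \<in> N then 0 else f' x)" for x
  have "(g has_integral f b - f a) {a..b}"
    unfolding has_integral_real
  proof (intro allI impI)
    fix e :: real assume e: "e > 0"
    have "e / 2 > 0" using e by simp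
    from AC[unfolded abs_continuous_on_def, rule_format, OF this]
    obtain \<delta> where \<delta>: "\<delta> > 0" and small: "\<forall>(m::nat) l r.
        (\<forall>i<m. l i \<le> r i \<and> {l i..r i} \<subseteq> S) \<and> disjoint_family_on (\<lambda>i. {l i<..<r i}) {..<m} \<and>
        (\<Sum>i<m. r i - l i) < \<delta> \<longrightarrow> (\<Sum>i<m. dist (f (l i)) (f (r i))) < e / 2"
      by (elim exE conjE)
    obtain U where U: "open U" "N \<subseteq> U" "emeasure lborel U < ennreal \<delta>"
      using negligible_open_cover[OF N \<delta>] .
    define e' where "e' = e / (2 * (b - a + 1))"
    have e': "e' > 0" "e' * (b - a) < e / 2"
    proof -
      show "e' > 0" unfolding e'_def using e ab by simp
      then have "e' * (b - a) < e' * (b - a + 1)" by simp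
      also have "\<dots> = e / 2" unfolding e'_def using ab by (simp add: field_simps)
      finally show "e' * (b - a) < e / 2" .
    qed
    have "\<exists>\<eta>>0. (x \<in> N \<longrightarrow> ball x \<eta> \<subseteq> U) \<and> (x \<in> {a..b} - N \<longrightarrow>
        (\<forall>y\<in>{a..b}. norm (y - x) < \<eta> \<longrightarrow> norm (f y - f x - (y - x) *\<^sub>R f' x) \<le> e' * norm (y - x)))" for x
    proof (cases "x \<in> N")
      case True
      then show ?thesis
        using U(1,2) open_contains_ball by blast
    next
      case False
      show ?thesis
      proof (cases "x \<in> {a..b}")
        case True
        with False d[of x] e'(1) show ?thesis
          unfolding has_vector_derivative_def has_derivative_within_alt by auto
      next
        case F: False
        with False show ?thesis by (auto intro: exI[of _ 1])
      qed
    qed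
    then have "\<forall>x. \<exists>\<eta>>0. (x \<in> N \<longrightarrow> ball x \<eta> \<subseteq> U) \<and> (x \<in> {a..b} - N \<longrightarrow>
        (\<forall>y\<in>{a..b}. norm (y - x) < \<eta> \<longrightarrow> norm (f y - f x - (y - x) *\<^sub>R f' x) \<le> e' * norm (y - x)))"
      by blast
    from choice[OF this] obtain \<eta> where \<eta>: "\<forall>x. \<eta> x > 0 \<and> (x \<in> N \<longrightarrow> ball x (\<eta> x) \<subseteq> U) \<and>
        (x \<in> {a..b} - N \<longrightarrow> (\<forall>y\<in>{a..b}. norm (y - x) < \<eta> x \<longrightarrow>
          norm (f y - f x - (y - x) *\<^sub>R f' x) \<le> e' * norm (y - x)))"
      by (elim exE)
    have \<eta>0: "\<eta> x > 0" for x using \<eta> by simp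
    have \<eta>U: "ball x (\<eta> x) \<subseteq> U" if "x \<in> N" for x using \<eta> that by simp
    have \<eta>d: "norm (f y - f x - (y - x) *\<^sub>R f' x) \<le> e' * norm (y - x)"
      if "x \<in> {a..b} - N" "y \<in> {a..b}" "norm (y - x) < \<eta> x" for x y
      using \<eta> that by blast
    show "\<exists>\<gamma>. gauge \<gamma> \<and> (\<forall>\<D>. \<D> tagged_division_of {a..b} \<and> \<gamma> fine \<D> \<longrightarrow>
            norm ((\<Sum>(x, k)\<in>\<D>. measure lborel k *\<^sub>R g x) - (f b - f a)) < e)"
    proof (intro exI conjI allI impI)
      show "gauge (\<lambda>x. ball x (\<eta> x))"
        using \<eta>0 by (simp add: gauge_def)
      fix D assume "D tagged_division_of {a..b} \<and> (\<lambda>x. ball x (\<eta> x)) fine D"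
      then have D: "D tagged_division_of {a..b}" and fine: "\<And>x k. (x, k) \<in> D \<Longrightarrow> k \<subseteq> ball x (\<eta> x)"
        by (auto simp: fine_def)
      note Dfin = tagged_division_ofD(1)[OF D]
      define l r where "l p = Inf (snd p)" and "r p = Sup (snd p)" for p :: "real \<times> real set"
      have iv: "snd p = {l p..r p}" "l p \<le> fst p" "fst p \<le> r p" "{l p..r p} \<subseteq> {a..b}"
        "{l p..r p} \<subseteq> ball (fst p) (\<eta> (fst p))" if pD: "p \<in> D" for p
      proof -
        obtain x k where p: "p = (x, k)" by fastforce
        obtain c d where k: "k = cbox c d" using tagged_division_ofD(4)[OF D] pD p by blast
        have xk: "x \<in> k" using tagged_division_ofD(2)[OF D] pD p by blast
        then have "c \<le> d" using k by auto
        then have lr: "l p = c" "r p = d" by (auto simp: l_def r_def p k)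
        show "snd p = {l p..r p}" using lr p k by simp
        show "l p \<le> fst p" "fst p \<le> r p" using lr p k xk by auto
        show "{l p..r p} \<subseteq> {a..b}" using tagged_division_ofD(3)[OF D pD[unfolded p]] lr k p by simp
        show "{l p..r p} \<subseteq> ball (fst p) (\<eta> (fst p))" using fine[OF pD[unfolded p]] lr k p by simp
      qed
      define D1 D2 where "D1 = {p \<in> D. fst p \<in> N}" and "D2 = {p \<in> D. fst p \<notin> N}"
      have D12: "D = D1 \<union> D2" "D1 \<inter> D2 = {}" "finite D1" "finite D2"
        using Dfin by (auto simp: D1_def D2_def)
      define E where "E p = measure lborel (snd p) *\<^sub>R g (fst p) - (f (r p) - f (l p))" for p
      have len: "measure lborel (snd p) = r p - l p" if "p \<in> D" for p
        using iv[OF that] by simp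
      have total: "(\<Sum>p\<in>D. measure lborel (snd p)) = b - a"
        using additive_content_tagged_division[of D a b] D ab by (simp add: case_prod_unfold)
      have "(\<Sum>(x, k)\<in>D. measure lborel k *\<^sub>R g x) - (f b - f a) = (\<Sum>p\<in>D. E p)"
        using additive_tagged_division_1[OF ab D, of f]
        by (simp add: E_def sum_subtractf case_prod_unfold l_def r_def)
      also have "\<dots> = (\<Sum>p\<in>D1. E p) + (\<Sum>p\<in>D2. E p)"
        using D12 by (simp add: sum.union_disjoint)
      finally have split: "(\<Sum>(x, k)\<in>D. measure lborel k *\<^sub>R g x) - (f b - f a) = (\<Sum>p\<in>D1. E p) + (\<Sum>p\<in>D2. E p)" .
      have "norm (\<Sum>p\<in>D2. E p) \<le> (\<Sum>p\<in>D2. e' * measure lborel (snd p))"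
      proof (rule sum_norm_le)
        fix p assume "p \<in> D2"
        then have pD: "p \<in> D" and pN: "fst p \<notin> N" by (auto simp: D2_def)
        define x where "x = fst p"
        note ivp = iv[OF pD, folded x_def]
        have x: "x \<in> {a..b} - N" using ivp pN by (auto simp: x_def)
        have sub: "l p \<in> {a..b}" "r p \<in> {a..b}" "norm (l p - x) < \<eta> x" "norm (r p - x) < \<eta> x"
        proof -
          have "l p \<in> {l p..r p}" "r p \<in> {l p..r p}" using ivp(2,3) by auto
          then have "l p \<in> {a..b}" "r p \<in> {a..b}" "l p \<in> ball x (\<eta> x)" "r p \<in> ball x (\<eta> x)"
            using subsetD[OF ivp(4)] subsetD[OF ivp(5)] by blast+
          then show "l p \<in> {a..b}" "r p \<in> {a..b}" "norm (l p - x) < \<eta> x" "norm (r p - x) < \<eta> x"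
            by (auto simp: dist_real_def)
        qed
        have "E p = (f (l p) - f x - (l p - x) *\<^sub>R f' x) - (f (r p) - f x - (r p - x) *\<^sub>R f' x)"
          using pN by (simp add: E_def len[OF pD] g_def x_def algebra_simps)
        also have "norm \<dots> \<le> e' * norm (l p - x) + e' * norm (r p - x)"
          by (intro order_trans[OF norm_triangle_ineq4] add_mono \<eta>d[OF x] sub)
        also have "\<dots> = e' * measure lborel (snd p)"
          using ivp(2,3) by (simp add: len[OF pD] algebra_simps)
        finally show "norm (E p) \<le> e' * measure lborel (snd p)" .
      qed
      also have "\<dots> \<le> (\<Sum>p\<in>D. e' * measure lborel (snd p))"
        using e'(1) Dfin D12 by (intro sum_mono2) auto
      also have "\<dots> = e' * (b - a)"
        by (simp add: total sum_distrib_left[symmetric])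
      finally have part2: "norm (\<Sum>p\<in>D2. E p) < e / 2" using e' by simp
      \<comment> \<open>Absolute continuity speaks of finite sequences of intervals, so the tagged intervals are
        enumerated.\<close>
      obtain h where h: "bij_betw h {..<card D1} D1"
        using ex_bij_betw_nat_finite[OF D12(3)] by (auto simp: atLeast0LessThan)
      have hD: "h i \<in> D1" if "i < card D1" for i
        using h that by (auto simp: bij_betw_def)
      have disj: "disjoint_family_on (\<lambda>i. {l (h i)<..<r (h i)}) {..<card D1}"
        unfolding disjoint_family_on_def
      proof (intro ballI impI)
        fix i j assume ij: "i \<in> {..<card D1}" "j \<in> {..<card D1}" "i \<noteq> j"
        then have ne: "h i \<noteq> h j" using h by (auto simp: bij_betw_def inj_on_def)
        have D: "h i \<in> D" "h j \<in> D" using hD ij by (auto simp: D1_def)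
        have "interior (snd (h i)) \<inter> interior (snd (h j)) = {}"
          using tagged_division_ofD(5)[OF \<open>D tagged_division_of {a..b}\<close>,
              of "fst (h i)" "snd (h i)" "fst (h j)" "snd (h j)"] D ne by simp
        then show "{l (h i)<..<r (h i)} \<inter> {l (h j)<..<r (h j)} = {}"
          using iv(1)[OF D(1)] iv(1)[OF D(2)] by (simp add: interior_atLeastAtMost_real)
      qed
      have sumlen: "(\<Sum>i<card D1. r (h i) - l (h i)) < \<delta>"
      proof -
        have nn: "0 \<le> r (h i) - l (h i)" if "i < card D1" for i
          using iv[of "h i"] hD[OF that] by (auto simp: D1_def)
        have "ennreal (\<Sum>i<card D1. r (h i) - l (h i)) = (\<Sum>i<card D1. ennreal (r (h i) - l (h i)))"
          using nn by (intro sum_ennreal[symmetric]) auto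
        also have "\<dots> = (\<Sum>i<card D1. emeasure lborel {l (h i)<..<r (h i)})"
          using nn by (intro sum.cong) auto
        also have "\<dots> = emeasure lborel (\<Union>i\<in>{..<card D1}. {l (h i)<..<r (h i)})"
          using disj by (intro sum_emeasure) auto
        also have "\<dots> \<le> emeasure lborel U"
        proof (rule emeasure_mono)
          show "(\<Union>i\<in>{..<card D1}. {l (h i)<..<r (h i)}) \<subseteq> U"
          proof
            fix y assume "y \<in> (\<Union>i\<in>{..<card D1}. {l (h i)<..<r (h i)})"
            then obtain i where i: "i < card D1" "y \<in> {l (h i)..r (h i)}" by force
            have D: "h i \<in> D" and Ni: "fst (h i) \<in> N" using hD[OF i(1)] by (auto simp: D1_def)
            show "y \<in> U"
              using iv(5)[OF D] \<eta>U[OF Ni] i(2) by blast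
          qed
        qed (use U in auto)
        also have "\<dots> < ennreal \<delta>" by (rule U)
        finally show ?thesis using sum_nonneg[of "{..<card D1}" "\<lambda>i. r (h i) - l (h i)"] nn
          by (simp add: ennreal_less_iff)
      qed
      have "norm (\<Sum>p\<in>D1. E p) \<le> (\<Sum>p\<in>D1. dist (f (l p)) (f (r p)))"
        by (rule sum_norm_le) (auto simp: D1_def E_def g_def dist_norm norm_minus_commute)
      also have "\<dots> = (\<Sum>i<card D1. dist (f (l (h i))) (f (r (h i))))"
        using sum.reindex_bij_betw[OF h, of "\<lambda>p. dist (f (l p)) (f (r p))"] by simp
      also have "\<dots> < e / 2"
      proof (rule small[rule_format], intro conjI disj sumlen allI impI)
        fix i assume "i < card D1"
        then have "h i \<in> D" using hD by (auto simp: D1_def)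
        from iv[OF this] show "l (h i) \<le> r (h i)" "{l (h i)..r (h i)} \<subseteq> S" using S by auto
      qed
      finally have part1: "norm (\<Sum>p\<in>D1. E p) < e / 2" .
      show "norm ((\<Sum>(x, k)\<in>D. measure lborel k *\<^sub>R g x) - (f b - f a)) < e"
        unfolding split using norm_triangle_ineq[of "\<Sum>p\<in>D1. E p" "\<Sum>p\<in>D2. E p"] part1 part2 by linarith
    qed
  qed
  then show ?thesis
    by (rule has_integral_spike[OF N, rotated]) (auto simp: g_def)
qed

section \<open>The discrete Fourier transform and the discrete Wirtinger inequality\<close>

lemma root_of_unity_sum:
  fixes d :: int and N :: nat
  assumes N: "N > 0"
  shows "(\<Sum>h<N. cis (2 * pi * (real h * real_of_int d) / N)) = (if int N dvd d then of_nat N else 0)"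
proof -
  define z where "z = cis (2 * pi * real_of_int d / N)"
  have pow: "cis (2 * pi * (real h * real_of_int d) / N) = z ^ h" for h
    unfolding z_def Complex.DeMoivre by (rule arg_cong[of _ _ cis]) simp
  have "z ^ N = cis (2 * pi * real_of_int d)"
    unfolding z_def Complex.DeMoivre using N by (intro arg_cong[of _ _ cis]) simp
  then have zN: "z ^ N = 1"
    using cis_multiple_2pi[of "real_of_int d"] by simp
  show ?thesis
  proof (cases "int N dvd d")
    case True
    then obtain q where q: "d = int N * q" by blast
    have "z = 1"
      unfolding z_def q using N cis_multiple_2pi[of "real_of_int q"] by (simp add: mult_ac)
    then show ?thesis using True by (simp add: pow)
  next
    case False
    have "z \<noteq> 1"
    proof
      assume "z = 1"
      then have "cos (2 * pi * real_of_int d / N) = 1"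
        unfolding z_def by (metis cis.sel(1) one_complex.sel(1))
      then obtain q :: int where "2 * pi * real_of_int d / N = real_of_int q * 2 * pi"
        unfolding cos_one_2pi_int by blast
      then have "real_of_int d = real_of_int (q * int N)"
        using N by (simp add: field_simps)
      then have "d = q * int N" by linarith
      with False show False by simp
    qed
    then show ?thesis using False zN by (simp add: pow geometric_sum)
  qed
qed

definition dft :: "nat \<Rightarrow> (nat \<Rightarrow> complex) \<Rightarrow> nat \<Rightarrow> complex" where
  "dft N v h = (\<Sum>j<N. v j * cis (- 2 * pi * (real h * real j) / N))"

text \<open>Expanding the squares leaves the inner sum over \<open>h\<close>, which by the orthogonality of the characters
  is \<open>N\<close> on the diagonal and zero elsewhere.\<close>

lemma dft_Parseval:
  assumes N: "N > 0"
  shows "(\<Sum>h<N. (cmod (dft N v h))\<^sup>2) = N * (\<Sum>j<N. (cmod (v j))\<^sup>2)"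
proof -
  have "(\<Sum>h<N. dft N v h * cnj (dft N v h))
      = (\<Sum>h<N. \<Sum>j<N. \<Sum>i<N. v j * cnj (v i) * cis (2 * pi * (real h * real_of_int (int i - int j)) / N))"
  proof (intro sum.cong refl)
    fix h
    have "dft N v h * cnj (dft N v h) = (\<Sum>j<N. \<Sum>i<N. (v j * cis (- 2 * pi * (real h * real j) / N)) *
        (cnj (v i) * cis (2 * pi * (real h * real i) / N)))"
      by (simp add: dft_def cnj_sum sum_product cis_cnj)
    also have "\<dots> = (\<Sum>j<N. \<Sum>i<N. v j * cnj (v i) * cis (2 * pi * (real h * real_of_int (int i - int j)) / N))"
    proof (intro sum.cong refl)
      fix j i
      have "cis (- 2 * pi * (real h * real j) / N) * cis (2 * pi * (real h * real i) / N)
         = cis (2 * pi * (real h * real_of_int (int i - int j)) / N)"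
        unfolding cis_mult by (intro arg_cong[of _ _ cis]) (simp add: field_simps add_divide_distrib[symmetric])
      then show "(v j * cis (- 2 * pi * (real h * real j) / N)) * (cnj (v i) * cis (2 * pi * (real h * real i) / N))
          = v j * cnj (v i) * cis (2 * pi * (real h * real_of_int (int i - int j)) / N)"
        by (metis (no_types, lifting) mult.assoc mult.left_commute)
    qed
    finally show "dft N v h * cnj (dft N v h) = (\<Sum>j<N. \<Sum>i<N. v j * cnj (v i) *
        cis (2 * pi * (real h * real_of_int (int i - int j)) / N))" .
  qed
  also have "\<dots> = (\<Sum>j<N. \<Sum>i<N. v j * cnj (v i) *
      (\<Sum>h<N. cis (2 * pi * (real h * real_of_int (int i - int j)) / N)))"
    by (subst sum.swap, rule sum.cong[OF refl], subst sum.swap) (simp add: sum_distrib_left)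
  also have "\<dots> = (\<Sum>j<N. \<Sum>i<N. if i = j then v j * cnj (v i) * of_nat N else 0)"
  proof (intro sum.cong refl)
    fix j i assume "j \<in> {..<N}" "i \<in> {..<N}"
    then have "\<bar>int i - int j\<bar> < int N" by auto
    then have "int N dvd int i - int j \<longleftrightarrow> i = j"
      using zdvd_imp_le[of "int N" "\<bar>int i - int j\<bar>"] by auto
    then show "v j * cnj (v i) * (\<Sum>h<N. cis (2 * pi * (real h * real_of_int (int i - int j)) / N))
        = (if i = j then v j * cnj (v i) * of_nat N else 0)"
      unfolding root_of_unity_sum[OF N] by simp
  qed
  also have "\<dots> = of_nat N * (\<Sum>j<N. v j * cnj (v j))"
    by (simp add: sum_distrib_left mult_ac)
  finally have "complex_of_real (\<Sum>h<N. (cmod (dft N v h))\<^sup>2)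
      = complex_of_real (N * (\<Sum>j<N. (cmod (v j))\<^sup>2))"
    by (simp add: complex_norm_square[symmetric])
  then show ?thesis by (simp only: of_real_eq_iff)
qed

lemma dft_shift:
  assumes N: "N > 0" and per: "v N = v 0"
  shows "dft N (\<lambda>j. v (Suc j)) h = cis (2 * pi * real h / N) * dft N v h"
proof -
  define w where "w j = v j * cis (- 2 * pi * (real h * real j) / N)" for j
  have "w N = w 0"
    using N cis_multiple_2pi[of "- real h"] by (simp add: w_def per mult.assoc)
  then have shift: "(\<Sum>j<N. w (Suc j)) = (\<Sum>j<N. w j)"
    using sum.lessThan_Suc_shift[of w N] sum.lessThan_Suc[of w N] by simp
  have "v (Suc j) * cis (- 2 * pi * (real h * real j) / N) = cis (2 * pi * real h / N) * w (Suc j)" for j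
  proof -
    have "cis (- 2 * pi * (real h * real j) / N)
        = cis (2 * pi * real h / N) * cis (- 2 * pi * (real h * real (Suc j)) / N)"
      unfolding cis_mult by (intro arg_cong[of _ _ cis]) (simp add: field_simps add_divide_distrib[symmetric])
    then show ?thesis by (simp add: w_def)
  qed
  then have "dft N (\<lambda>j. v (Suc j)) h = cis (2 * pi * real h / N) * (\<Sum>j<N. w (Suc j))"
    by (simp add: dft_def sum_distrib_left)
  with shift show ?thesis by (simp add: dft_def w_def)
qed

lemma cmod_cis_minus_one: "cmod (cis t - 1) = 2 * \<bar>sin (t / 2)\<bar>"
proof -
  have "cis t - 1 = cis (t / 2) * (2 * \<i> * of_real (sin (t / 2)))"
  proof -
    have "cis t = cis (t / 2) * cis (t / 2)" by (simp add: cis_mult)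
    moreover have "1 = cis (t / 2) * cis (- (t / 2))" by (simp add: cis_mult)
    moreover have "cis (t / 2) - cis (- (t / 2)) = 2 * \<i> * of_real (sin (t / 2))"
      by (simp add: complex_eq_iff)
    ultimately show ?thesis by (metis right_diff_distrib)
  qed
  then show ?thesis by (simp add: norm_mult)
qed

text \<open>The difference operator multiplies the coefficient of index \<open>h\<close> by \<open>e\<^sup>2\<^sup>\<pi>\<^sup>i\<^sup>h\<^sup>/\<^sup>N - 1\<close>, of modulus
  \<open>2 sin (\<pi> h / N)\<close>, which for \<open>0 < h < N\<close> is least at \<open>h = 1\<close> and at \<open>h = N - 1\<close>. The coefficient of index 0 is the sum of the sequence; it is the term
  subtracted on the left.\<close>

lemma discrete_Wirtinger:
  assumes N: "N > 0" and per: "v N = v 0"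
  shows "4 * (sin (pi / N))\<^sup>2 * (N * (\<Sum>j<N. (cmod (v j))\<^sup>2) - (cmod (\<Sum>j<N. v j))\<^sup>2)
    \<le> N * (\<Sum>j<N. (cmod (v (Suc j) - v j))\<^sup>2)"
proof -
  have d: "dft N (\<lambda>j. v (Suc j) - v j) h = (cis (2 * pi * real h / N) - 1) * dft N v h" for h
    using dft_shift[of N v h, OF N per]
    by (simp add: dft_def left_diff_distrib sum_subtractf)
  have "4 * (sin (pi / N))\<^sup>2 * (N * (\<Sum>j<N. (cmod (v j))\<^sup>2) - (cmod (\<Sum>j<N. v j))\<^sup>2)
      = (\<Sum>h\<in>{..<N} - {0}. 4 * (sin (pi / N))\<^sup>2 * (cmod (dft N v h))\<^sup>2)"
  proof -
    have "(\<Sum>h<N. (cmod (dft N v h))\<^sup>2) = (cmod (dft N v 0))\<^sup>2 + (\<Sum>h\<in>{..<N} - {0}. (cmod (dft N v h))\<^sup>2)"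
      using N by (intro sum.remove) auto
    moreover have "dft N v 0 = (\<Sum>j<N. v j)" by (simp add: dft_def)
    ultimately show ?thesis
      using dft_Parseval[OF N, of v] by (simp add: sum_distrib_left[symmetric])
  qed
  also have "\<dots> \<le> (\<Sum>h\<in>{..<N} - {0}. (cmod (dft N (\<lambda>j. v (Suc j) - v j) h))\<^sup>2)"
  proof (rule sum_mono)
    fix h assume h: "h \<in> {..<N} - {0}"
    have "sin (pi / N) \<le> sin (pi * h / N)"
    proof (cases "2 * h \<le> N")
      case True
      then have "2 * real h \<le> real N" by linarith
      with h N show ?thesis
        by (intro sin_monotone_2pi_le) (auto simp: field_simps intro: order_trans[of _ 0])
    next
      case False
      then have "2 * real h \<ge> real N" by linarith
      moreover have "real h + 1 \<le> real N" using h by auto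
      ultimately have "sin (pi / N) \<le> sin (pi * (real N - real h) / N)"
      proof (intro sin_monotone_2pi_le)
        show "pi / N \<le> pi * (real N - real h) / N"
          using \<open>real h + 1 \<le> real N\<close> N by (intro divide_right_mono) auto
        show "pi * (real N - real h) / N \<le> pi / 2"
          using \<open>2 * real h \<ge> real N\<close> N by (simp add: field_simps)
        show "- (pi / 2) \<le> pi / N"
          by (rule order_trans[of _ 0]) simp_all
      qed
      also have "pi * (real N - real h) / N = pi - pi * h / N"
        using N by (simp add: diff_divide_distrib right_diff_distrib)
      finally show ?thesis by simp
    qed
    moreover have "0 \<le> sin (pi / N)"
      using N by (intro sin_ge_zero) (auto simp: field_simps)
    ultimately have "(sin (pi / N))\<^sup>2 \<le> (sin (pi * h / N))\<^sup>2"
      by (intro power_mono)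
    then have "4 * (sin (pi / N))\<^sup>2 \<le> (cmod (cis (2 * pi * real h / N) - 1))\<^sup>2"
      unfolding cmod_cis_minus_one by (simp add: power_mult_distrib mult_ac)
    then show "4 * (sin (pi / N))\<^sup>2 * (cmod (dft N v h))\<^sup>2
        \<le> (cmod (dft N (\<lambda>j. v (Suc j) - v j) h))\<^sup>2"
      unfolding d norm_mult power_mult_distrib by (intro mult_right_mono) auto
  qed
  also have "\<dots> \<le> (\<Sum>h<N. (cmod (dft N (\<lambda>j. v (Suc j) - v j) h))\<^sup>2)"
    by (intro sum_mono2) auto
  also have "\<dots> = N * (\<Sum>j<N. (cmod (v (Suc j) - v j))\<^sup>2)"
    by (rule dft_Parseval[OF N])
  finally show ?thesis .
qed

section \<open>The Wirtinger inequality\<close>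

lemma Riemann_sum_tendsto:
  fixes f :: "real \<Rightarrow> 'a::euclidean_space"
  assumes c: "continuous_on {0..1} f"
  shows "(\<lambda>N. (\<Sum>j<N. f (real j / real N)) /\<^sub>R real N) \<longlonglongrightarrow> integral {0..1} f"
proof (rule LIMSEQ_I)
  fix e :: real assume "e > 0"
  then have e2: "e / 2 > 0" by simp
  obtain \<delta> where \<delta>: "\<delta> > 0" "\<And>x y. \<lbrakk>x \<in> {0..1}; y \<in> {0..1}; dist y x < \<delta>\<rbrakk> \<Longrightarrow> dist (f y) (f x) < e / 2"
    using compact_uniformly_continuous[OF c compact_Icc] e2 unfolding uniformly_continuous_on_def by metis
  have fi: "f integrable_on {0..1}"
    by (rule integrable_continuous_interval[OF c])
  obtain N0 :: nat where N0: "1 / \<delta> < N0"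
    using reals_Archimedean2 by blast
  show "\<exists>no. \<forall>N\<ge>no. norm ((\<Sum>j<N. f (real j / N)) /\<^sub>R N - integral {0..1} f) < e"
  proof (intro exI allI impI)
    fix N assume "N \<ge> N0"
    then have N: "1 / \<delta> < N" using N0 by linarith
    have Npos: "N > 0" using N \<delta>(1) by (cases N) auto
    have cell: "norm (f (real j / N) /\<^sub>R N - integral {real j / N..Suc j / N} f) \<le> e / 2 / N" if j: "j < N" for j
    proof -
      have le: "real j / N \<le> Suc j / N" by (simp add: divide_right_mono)
      have range: "{real j / N..Suc j / N} \<subseteq> {0..1}"
        using j Npos by (auto simp: field_simps intro: order_trans)
      have len: "real (Suc j) / N - real j / N = 1 / N" by (simp add: add_divide_distrib)
      have fi': "f integrable_on {real j / N..Suc j / N}"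
        by (rule integrable_subinterval_real[OF fi range])
      have "((\<lambda>x. f (real j / N) - f x) has_integral (f (real j / N) /\<^sub>R N - integral {real j / N..Suc j / N} f)) {j / N..Suc j / N}"
        using has_integral_diff[OF has_integral_const_real[of "f (real j / N)" "j / N" "Suc j / N"] integrable_integral[OF fi']] le
        by (simp add: add_divide_distrib inverse_eq_divide)
      moreover have "norm (f (real j / N) - f x) \<le> e / 2" if x: "x \<in> {real j / N..Suc j / N}" for x
      proof -
        have "dist (j / N) x < \<delta>"
        proof -
          have "dist (j / N) x \<le> 1 / N" using x len by (auto simp: dist_real_def)
          also have "\<dots> < \<delta>" using N \<delta>(1) Npos by (simp add: field_simps)
          finally show ?thesis .
        qed
        then have "dist (f (real j / N)) (f x) < e / 2"
          using subsetD[OF range x] subsetD[OF range, of "real j / N"] le by (intro \<delta>(2)) auto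
        then show ?thesis by (simp add: dist_norm)
      qed
      ultimately have "norm (f (real j / N) /\<^sub>R N - integral {real j / N..Suc j / N} f)
          \<le> (e / 2) * measure lborel {real j / N..Suc j / N}"
        using e2 by (intro has_integral_bound_real[where f = "\<lambda>x. f (real j / N) - f x" and S = "{}"]) auto
      then show ?thesis using le len by simp
    qed
    have "integral {0..1} f = (\<Sum>j<N. integral {real j / N..Suc j / N} f)"
      using integral_uniform_partition[OF fi _ Npos] by simp
    then have "(\<Sum>j<N. f (real j / N)) /\<^sub>R N - integral {0..1} f
        = (\<Sum>j<N. f (real j / N) /\<^sub>R N - integral {real j / N..Suc j / N} f)"
      by (simp add: scaleR_sum_right sum_subtractf)
    also have "norm \<dots> \<le> (\<Sum>j<N. e / 2 / N)"
      by (rule sum_norm_le) (use cell in auto)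
    also have "\<dots> < e" using Npos e2 by simp
    finally show "norm ((\<Sum>j<N. f (real j / N)) /\<^sub>R N - integral {0..1} f) < e" .
  qed
qed

lemma n_sin_pi_over_n_tendsto: "(\<lambda>N. real N * sin (pi / N)) \<longlonglongrightarrow> pi"
proof -
  have "((\<lambda>h. sin h / h) \<longlongrightarrow> 1) (at (0::real))"
    using DERIV_sin[of 0] by (simp add: DERIV_def)
  moreover have "filterlim (\<lambda>N. pi / real N) (at 0) sequentially"
    unfolding filterlim_at
  proof
    show "\<forall>\<^sub>F N in sequentially. pi / real N \<in> UNIV \<and> pi / real N \<noteq> 0"
      using eventually_gt_at_top[of 0] by eventually_elim simp
    show "(\<lambda>N. pi / real N) \<longlonglongrightarrow> 0"
      by (intro tendsto_divide_0[OF tendsto_const] filterlim_real_sequentially filterlim_at_top_imp_at_infinity)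
  qed
  ultimately have "(\<lambda>N. sin (pi / real N) / (pi / real N)) \<longlonglongrightarrow> 1"
    by (rule filterlim_compose)
  then have "(\<lambda>N. pi * (sin (pi / real N) / (pi / real N))) \<longlonglongrightarrow> pi * 1"
    by (intro tendsto_intros)
  then show ?thesis by (simp add: field_simps)
qed

text \<open>This is \<open>x \<le> tan x\<close> at \<open>x = \<pi> / 6\<close>. It decides that the factor 2 suffices in the aliasing bound.\<close>

lemma pi_le_sqrt_12: "pi \<le> sqrt 12"
proof -
  have "tan 0 - 0 \<le> tan (pi / 6) - pi / 6"
  proof (rule DERIV_nonneg_imp_nondecreasing[of 0 "pi / 6" "\<lambda>x. tan x - x"])
    fix x :: real assume x: "0 \<le> x" "x \<le> pi / 6"
    then have c: "0 < cos x" using pi_gt_zero by (intro cos_gt_zero_pi) linarith+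
    then have "1 \<le> inverse ((cos x)\<^sup>2)"
      by (simp add: one_le_inverse_iff power_le_one)
    with c show "\<exists>y. ((\<lambda>x. tan x - x) has_real_derivative y) (at x) \<and> 0 \<le> y"
      by (intro exI[of _ "inverse ((cos x)\<^sup>2) - 1"] conjI) (auto intro!: derivative_eq_intros)
  qed simp
  then have "pi \<le> 6 / sqrt 3" by (simp add: tan_30)
  also have "sqrt 36 = 6" by (rule real_sqrt_unique) auto
  then have "6 / sqrt 3 = sqrt (36 / 3)" unfolding real_sqrt_divide by simp
  finally show ?thesis by simp
qed

text \<open>The limit of the discrete inequality for the values of \<open>v\<close> on a grid of \<open>N\<close> points: the squared
  increments are bounded by integrals of \<open>|v'|\<^sup>2\<close> over the cells, the other sums are Riemann sums,
  and \<open>2 N sin (\<pi> / N)\<close> tends to \<open>2 \<pi>\<close>.\<close>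

lemma Wirtinger:
  assumes p: "L2_primitive v v'" and per: "v 0 = v 1" and mean: "integral {0..1} v = 0"
  shows "2 * pi * L2_norm {0..1} v \<le> L2_norm {0..1} v'"
proof -
  have cv: "continuous_on {0..1} v" by (rule L2_primitive_continuous[OF p])
  define A where "A N = (\<Sum>j<N. (cmod (v (real j / N)))\<^sup>2) /\<^sub>R real N" for N :: nat
  define B where "B N = (\<Sum>j<N. v (real j / N)) /\<^sub>R real N" for N :: nat
  have A: "A \<longlonglongrightarrow> (L2_norm {0..1} v)\<^sup>2"
    unfolding A_def L2_norm_sq
    by (rule Riemann_sum_tendsto[of "\<lambda>x. (cmod (v x))\<^sup>2"]) (intro continuous_intros cv)
  have B: "B \<longlonglongrightarrow> 0"
    using Riemann_sum_tendsto[OF cv] unfolding B_def mean .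
  have ineq: "4 * (real N * sin (pi / N))\<^sup>2 * (A N - (cmod (B N))\<^sup>2) \<le> (L2_norm {0..1} v')\<^sup>2" if N: "N > 0" for N
  proof -
    define w where "w j = v (real j / N)" for j :: nat
    have "(\<Sum>j<N. (cmod (w (Suc j) - w j))\<^sup>2)
        \<le> (\<Sum>j<N. (1 / N) * integral {real j / N..Suc j / N} (\<lambda>x. (cmod (v' x))\<^sup>2))"
    proof (rule sum_mono)
      fix j assume j: "j \<in> {..<N}"
      have "real j / N \<le> Suc j / N" "Suc j / N \<le> 1"
        using j N by (auto simp: divide_right_mono)
      then have "(cmod (w (Suc j) - w j))\<^sup>2
          \<le> (Suc j / N - real j / N) * integral {real j / N..Suc j / N} (\<lambda>x. (cmod (v' x))\<^sup>2)"
        unfolding w_def by (intro L2_primitive_increment[OF p]) auto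
      then show "(cmod (w (Suc j) - w j))\<^sup>2 \<le> (1 / N) * integral {real j / N..Suc j / N} (\<lambda>x. (cmod (v' x))\<^sup>2)"
        by (simp add: diff_divide_distrib[symmetric])
    qed
    also have "\<dots> = (1 / N) * (L2_norm {0..1} v')\<^sup>2"
      using integral_uniform_partition[of "\<lambda>x. (cmod (v' x))\<^sup>2" 0 1 N] N L2_primitive_L2[OF p]
      by (simp add: L2_norm_sq L2_on_def sum_distrib_left[symmetric] sum_divide_distrib[symmetric])
    finally have diff: "N * (\<Sum>j<N. (cmod (w (Suc j) - w j))\<^sup>2) \<le> (L2_norm {0..1} v')\<^sup>2"
      using N by (simp add: field_simps)
    have "w N = w 0" using N per by (simp add: w_def)
    from discrete_Wirtinger[OF N this] diff
    have "4 * (sin (pi / N))\<^sup>2 * (N * (\<Sum>j<N. (cmod (w j))\<^sup>2) - (cmod (\<Sum>j<N. w j))\<^sup>2) \<le> (L2_norm {0..1} v')\<^sup>2"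
      by linarith
    also have "N * (\<Sum>j<N. (cmod (w j))\<^sup>2) - (cmod (\<Sum>j<N. w j))\<^sup>2 = (real N)\<^sup>2 * (A N - (cmod (B N))\<^sup>2)"
      using N by (simp add: A_def B_def w_def field_simps power2_eq_square)
    finally show ?thesis by (simp add: power_mult_distrib mult_ac)
  qed
  have "(\<lambda>N. 4 * (real N * sin (pi / N))\<^sup>2 * (A N - (cmod (B N))\<^sup>2))
      \<longlonglongrightarrow> 4 * pi\<^sup>2 * ((L2_norm {0..1} v)\<^sup>2 - (cmod 0)\<^sup>2)"
    by (intro tendsto_intros n_sin_pi_over_n_tendsto A B)
  then have "4 * pi\<^sup>2 * ((L2_norm {0..1} v)\<^sup>2 - (cmod 0)\<^sup>2) \<le> (L2_norm {0..1} v')\<^sup>2"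
    by (rule LIMSEQ_le_const2) (use ineq in \<open>auto intro!: exI[of _ 1]\<close>)
  then have "(2 * pi * L2_norm {0..1} v)\<^sup>2 \<le> (L2_norm {0..1} v')\<^sup>2"
    by (simp add: power_mult_distrib)
  then show ?thesis by (rule power2_le_imp_le) simp
qed

text \<open>Integrating \<open>v'\<close> against \<open>t - 1/2\<close> by parts gives \<open>v 0\<close>, because \<open>v\<close> has mean zero and equal
  values at the end points.\<close>

lemma periodic_mean_zero_endpoint_bound:
  assumes p: "L2_primitive v v'" and per: "v 0 = v 1" and mean: "integral {0..1} v = 0"
  shows "cmod (v 0) \<le> L2_norm {0..1} v' / sqrt 12"
proof -
  define \<phi> where "\<phi> t = complex_of_real (t - 1 / 2)" for t
  have \<phi>': "(\<phi> has_vector_derivative 1) (at x within {0..1})" for x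
    unfolding \<phi>_def by (auto intro!: derivative_eq_intros simp: of_real_def)
  have cphi: "continuous_on {0..1} \<phi>"
    unfolding \<phi>_def by (intro continuous_intros)
  have prod: "L2_primitive (\<lambda>x. v x * \<phi> x) (\<lambda>x. v' x * \<phi> x + v x * 1)"
    by (rule L2_primitive_mult[OF p \<phi>']) simp
  have vi: "v integrable_on {0..1}"
    by (intro integrable_continuous_interval L2_primitive_continuous[OF p])
  have phi01: "\<phi> 1 = 1 / 2" "\<phi> 0 = - (1 / 2)"
    by (simp_all add: \<phi>_def)
  have "v 1 * \<phi> 1 - v 0 * \<phi> 0 = v 0"
    unfolding phi01 per by simp
  then have "((\<lambda>x. v' x * \<phi> x + v x * 1) has_integral v 0) {0..1}"
    using L2_primitiveD[OF prod, of 0 1] by simp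
  from has_integral_diff[OF this integrable_integral[OF vi]]
  have "((\<lambda>x. v' x * \<phi> x) has_integral v 0) {0..1}"
    using mean by simp
  then have "cmod (v 0) \<le> L2_norm {0..1} v' * L2_norm {0..1} \<phi>"
    using L2_Cauchy_Schwarz[OF _ L2_primitive_L2[OF p] L2_on_continuous[OF cphi]]
    by (simp add: integral_unique)
  also have "L2_norm {0..1} \<phi> = 1 / sqrt 12"
  proof -
    have "((\<lambda>t::real. (t - 1 / 2)\<^sup>2) has_integral ((1 - 1 / 2) ^ 3 / 3 - (0 - 1 / 2) ^ 3 / 3)) {0..1}"
      by (intro fundamental_theorem_of_calculus)
         (auto intro!: derivative_eq_intros simp flip: has_real_derivative_iff_has_vector_derivative)
    moreover have "(cmod (\<phi> t))\<^sup>2 = (t - 1 / 2)\<^sup>2" for t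
      by (simp only: \<phi>_def norm_of_real power2_abs)
    ultimately have "((\<lambda>t. (cmod (\<phi> t))\<^sup>2) has_integral 1 / 12) {0..1}"
      by (simp add: power3_eq_cube)
    then show ?thesis
      unfolding L2_norm_def by (simp add: integral_unique real_sqrt_divide)
  qed
  finally show ?thesis by simp
qed

section \<open>Averaging over the cells of a uniform grid\<close>

text \<open>Pythagoras: subtracting the mean is an orthogonal projection.\<close>

lemma L2_norm_minus_mean_le:
  assumes u: "L2_on {0..1} u"
  shows "L2_norm {0..1} (\<lambda>x. u x - integral {0..1} u) \<le> L2_norm {0..1} u"
proof (rule power2_le_imp_le)
  define c where "c = integral {0..1} u"
  have ui: "u integrable_on {0..1}"
    using L2_on_absolutely_integrable[OF u] by (simp add: absolutely_integrable_on_def)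
  have u2: "(\<lambda>x. (cmod (u x))\<^sup>2) integrable_on {0..1}"
    using u by (simp add: L2_on_def)
  have "((\<lambda>x. u x * cnj c) has_integral c * cnj c) {0..1}"
    unfolding c_def by (intro has_integral_mult_left integrable_integral ui)
  from has_integral_linear[OF this bounded_linear_Re]
  have re: "((\<lambda>x. Re (u x * cnj c)) has_integral (cmod c)\<^sup>2) {0..1}"
    by (simp add: o_def complex_mult_cnj cmod_power2)
  have "((\<lambda>x. (cmod (u x))\<^sup>2 - 2 * Re (u x * cnj c) + (cmod c)\<^sup>2) has_integral
      ((L2_norm {0..1} u)\<^sup>2 - 2 * (cmod c)\<^sup>2 + (cmod c)\<^sup>2)) {0..1}"
    unfolding L2_norm_sq
    using has_integral_const_real[of "(cmod c)\<^sup>2" 0 1]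
    by (intro has_integral_add has_integral_diff has_integral_mult_right integrable_integral u2 re) simp
  moreover have "(cmod (u x))\<^sup>2 - 2 * Re (u x * cnj c) + (cmod c)\<^sup>2 = (cmod (u x - c))\<^sup>2" for x
    unfolding cmod_power2 by (simp add: power2_eq_square algebra_simps)
  ultimately have "(L2_norm {0..1} (\<lambda>x. u x - c))\<^sup>2 = (L2_norm {0..1} u)\<^sup>2 - (cmod c)\<^sup>2"
    unfolding L2_norm_sq[of _ "\<lambda>x. u x - c"] by (simp add: integral_unique)
  then show "(L2_norm {0..1} (\<lambda>x. u x - integral {0..1} u))\<^sup>2 \<le> (L2_norm {0..1} u)\<^sup>2"
    by (simp add: c_def)
qed simp

text \<open>The mean of \<open>u\<close> over the translates of a point by multiples of \<open>1/m\<close>, stretched to a function on the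
  unit interval. Of the Fourier coefficients of \<open>u\<close> it retains those whose index is a multiple of \<open>m\<close>.
  Its value at 0 is the rectangle rule with \<open>m\<close> nodes, and its integral is that of \<open>u\<close>.\<close>

definition fold_period :: "nat \<Rightarrow> (real \<Rightarrow> complex) \<Rightarrow> real \<Rightarrow> complex" where
  "fold_period m u t = (\<Sum>i<m. u ((t + real i) / m)) / of_nat m"

lemma has_integral_cell:
  fixes u :: "real \<Rightarrow> 'a::real_normed_vector"
  assumes m: "m > 0" and u: "(u has_integral J) {(a + real i) / m..(b + real i) / m}"
  shows "((\<lambda>t. u ((t + real i) / m)) has_integral real m *\<^sub>R J) {a..b}"
proof -
  have "(u has_integral J) (cbox ((a + real i) / m) ((b + real i) / m))" using u by simp
  from has_integral_affinity'[OF this, of "1 / m" "real i / m"] m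
  have "((\<lambda>t. u ((1 / m) *\<^sub>R t + real i / m)) has_integral J /\<^sub>R (1 / m) ^ DIM(real))
      (cbox (((a + real i) / m - real i / m) /\<^sub>R (1 / m)) (((b + real i) / m - real i / m) /\<^sub>R (1 / m)))"
    by simp
  moreover have "((x + real i) / m - real i / m) /\<^sub>R (1 / m) = x" for x
    using m by (simp add: add_divide_distrib)
  moreover have "(1 / m) *\<^sub>R t + real i / m = (t + real i) / m" for t
    by (simp add: add_divide_distrib)
  moreover have "J /\<^sub>R (1 / m) ^ DIM(real) = real m *\<^sub>R J"
    by simp
  ultimately show ?thesis by (simp only: box_real)
qed

lemma cell_subset: "i < m \<Longrightarrow> 0 \<le> t \<Longrightarrow> t \<le> 1 \<Longrightarrow> 0 \<le> (t + real i) / m \<and> (t + real i) / m \<le> 1"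
proof -
  assume i: "i < m" and t: "0 \<le> t" "t \<le> 1"
  have "real i + 1 \<le> real m" using i by linarith
  then have "t + real i \<le> real m" using t by linarith
  then show ?thesis using i t by simp
qed

lemma has_integral_fold_sum:
  fixes f :: "real \<Rightarrow> 'a::banach"
  assumes m: "m > 0" and f: "f integrable_on {0..1}"
  shows "((\<lambda>t. \<Sum>i<m. f ((t + real i) / m)) has_integral real m *\<^sub>R integral {0..1} f) {0..1}"
proof -
  have "((\<lambda>t. \<Sum>i<m. f ((t + real i) / m)) has_integral
      (\<Sum>i<m. real m *\<^sub>R integral {real i / m..Suc i / m} f)) {0..1}"
  proof (intro has_integral_sum has_integral_cell[OF m] finite_lessThan)
    fix i assume i: "i \<in> {..<m}"
    have "f integrable_on {real i / m..Suc i / m}"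
      using cell_subset[of i m 0] cell_subset[of i m 1] i
      by (intro integrable_subinterval_real[OF f]) (auto simp: add.commute)
    then show "(f has_integral integral {real i / m..Suc i / m} f) {(0 + real i) / m..(1 + real i) / m}"
      using integrable_integral by (simp add: add.commute)
  qed
  then show ?thesis
    using integral_uniform_partition[OF f _ m] by (simp add: scaleR_sum_right)
qed

lemma integral_fold_period:
  assumes m: "m > 0" and u: "u integrable_on {0..1}"
  shows "(fold_period m u has_integral integral {0..1} u) {0..1}"
proof -
  have "((\<lambda>t. (\<Sum>i<m. u ((t + real i) / m)) / of_nat m) has_integral (real m *\<^sub>R integral {0..1} u) / of_nat m) {0..1}"
    by (intro has_integral_divide has_integral_fold_sum m u)
  then show ?thesis
    using m by (simp add: fold_period_def[abs_def] scaleR_conv_of_real)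
qed

lemma L2_on_cell:
  assumes u: "L2_on {0..1} u" and i: "i < m"
  shows "L2_on {0..1} (\<lambda>t. u ((t + real i) / m))"
proof -
  have m: "m > 0" using i by simp
  have sub: "{(0 + real i) / m..(1 + real i) / m} \<subseteq> {0..1}"
    using cell_subset[of i m 0] cell_subset[of i m 1] i by auto
  have int: "(\<lambda>t. f ((t + real i) / m)) integrable_on {0..1}"
    if f: "f integrable_on {0..1}" for f :: "real \<Rightarrow> 'a::banach"
    using has_integral_cell[OF m integrable_integral[OF integrable_subinterval_real[OF f sub]]]
    by (auto simp: integrable_on_def)
  have "u integrable_on {0..1}"
    using L2_on_absolutely_integrable[OF u] by (simp add: absolutely_integrable_on_def)
  then have "(\<lambda>t. u ((t + real i) / m)) integrable_on {0..1}" by (rule int)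
  moreover have "(\<lambda>t. (cmod (u ((t + real i) / m)))\<^sup>2) integrable_on {0..1}"
    using u by (intro int[of "\<lambda>x. (cmod (u x))\<^sup>2"]) (simp add: L2_on_def)
  ultimately show ?thesis
    by (simp add: L2_on_def integrable_imp_measurable)
qed

lemma L2_on_fold_period:
  assumes "L2_on {0..1} u"
  shows "L2_on {0..1} (fold_period m u)"
proof -
  have "L2_on {0..1} (\<lambda>t. inverse (of_nat m) * (\<Sum>i<m. u ((t + real i) / m)))"
    by (intro L2_on_cmult L2_on_sum L2_on_cell assms) auto
  then show ?thesis by (simp add: fold_period_def[abs_def] divide_inverse mult.commute)
qed

text \<open>By convexity the square of the mean over the cells is at most the mean of the squares.\<close>

lemma L2_norm_fold_period_le:
  assumes m: "m > 0" and u: "L2_on {0..1} u"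
  shows "L2_norm {0..1} (fold_period m u) \<le> L2_norm {0..1} u"
proof (rule power2_le_imp_le)
  have u2: "(\<lambda>x. (cmod (u x))\<^sup>2) integrable_on {0..1}"
    using u by (simp add: L2_on_def)
  have f2: "(\<lambda>x. (cmod (fold_period m u x))\<^sup>2) integrable_on {0..1}"
    using L2_on_fold_period[OF u] by (simp add: L2_on_def)
  have "((\<lambda>t. (\<Sum>i<m. (cmod (u ((t + real i) / m)))\<^sup>2) / m) has_integral
      (real m *\<^sub>R integral {0..1} (\<lambda>x. (cmod (u x))\<^sup>2)) / m) {0..1}"
    by (intro has_integral_divide has_integral_fold_sum[of m "\<lambda>x. (cmod (u x))\<^sup>2"] m u2)
  then have i: "((\<lambda>t. (\<Sum>i<m. (cmod (u ((t + real i) / m)))\<^sup>2) / m) has_integral (L2_norm {0..1} u)\<^sup>2) {0..1}"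
    using m by (simp add: L2_norm_sq)
  show "(L2_norm {0..1} (fold_period m u))\<^sup>2 \<le> (L2_norm {0..1} u)\<^sup>2"
    unfolding L2_norm_sq[of _ "fold_period m u"]
  proof (rule has_integral_le[OF integrable_integral[OF f2] i])
    fix t
    have "cmod (fold_period m u t) \<le> (\<Sum>i<m. cmod (u ((t + real i) / m))) / m"
      unfolding fold_period_def by (simp add: norm_divide divide_right_mono norm_sum)
    then have "(cmod (fold_period m u t))\<^sup>2 \<le> ((\<Sum>i<m. cmod (u ((t + real i) / m))) / m)\<^sup>2"
      by (intro power_mono) auto
    also have "\<dots> \<le> ((\<Sum>i<m. (cmod (u ((t + real i) / m)))\<^sup>2) * real m) / (real m)\<^sup>2"
      using sum_squared_le_sum_of_squares[of "\<lambda>i. cmod (u ((t + real i) / m))" "{..<m}"]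
      unfolding power_divide by (intro divide_right_mono) auto
    also have "\<dots> = (\<Sum>i<m. (cmod (u ((t + real i) / m)))\<^sup>2) / m"
      using m by (simp add: power2_eq_square)
    finally show "(cmod (fold_period m u t))\<^sup>2 \<le> (\<Sum>i<m. (cmod (u ((t + real i) / m)))\<^sup>2) / m" .
  qed
qed simp

lemma fold_period_periodic:
  assumes "u 0 = u 1" "m > 0"
  shows "fold_period m u 0 = fold_period m u 1"
proof -
  have "(\<Sum>i<m. u (real (Suc i) / m)) = (\<Sum>i<m. u (real i / m))"
    using sum.lessThan_Suc_shift[of "\<lambda>i. u (real i / m)" m] sum.lessThan_Suc[of "\<lambda>i. u (real i / m)" m] assms
    by simp
  then show ?thesis by (simp add: fold_period_def add.commute)
qed

lemma L2_primitive_fold_period: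
  assumes m: "m > 0" and p: "L2_primitive u u'"
  shows "L2_primitive (fold_period m u) (\<lambda>t. fold_period m u' t / of_nat m)"
  unfolding L2_primitive_def
proof (intro conjI allI impI)
  show "L2_on {0..1} (\<lambda>t. fold_period m u' t / of_nat m)"
    using L2_on_cmult[OF L2_on_fold_period[OF L2_primitive_L2[OF p], of m], of "inverse (of_nat m)"]
    by (simp add: divide_inverse mult.commute)
  fix a b :: real assume ab: "0 \<le> a" "a \<le> b" "b \<le> 1"
  have "((\<lambda>t. (\<Sum>i<m. u' ((t + real i) / m)) / of_nat m / of_nat m) has_integral
     (\<Sum>i<m. real m *\<^sub>R (u ((b + real i) / m) - u ((a + real i) / m))) / of_nat m / of_nat m) {a..b}"
  proof (intro has_integral_divide has_integral_sum has_integral_cell[OF m] finite_lessThan)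
    fix i assume "i \<in> {..<m}"
    then show "(u' has_integral u ((b + real i) / m) - u ((a + real i) / m)) {(a + real i) / m..(b + real i) / m}"
      using cell_subset[of i m a] cell_subset[of i m b] ab
      by (intro L2_primitiveD[OF p]) (auto simp: divide_right_mono)
  qed
  then show "((\<lambda>t. fold_period m u' t / of_nat m) has_integral fold_period m u b - fold_period m u a) {a..b}"
    using m by (simp add: fold_period_def scaleR_conv_of_real sum_distrib_left[symmetric] sum_subtractf diff_divide_distrib)
qed

section \<open>Error bounds for periodic functions\<close>

text \<open>If \<open>h l\<close> is the \<open>l\<close>-th derivative of a periodic function multiplied by \<open>e\<^sup>-\<^sup>\<kappa>\<^sup>x\<close>, then by the product
  rule \<open>h (l + 1)\<close> arises from \<open>h l\<close> by applying \<open>d/dx + \<kappa>\<close>. Only this relation is recorded.\<close>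

definition periodic_chain :: "nat \<Rightarrow> complex \<Rightarrow> (nat \<Rightarrow> real \<Rightarrow> complex) \<Rightarrow> bool" where
  "periodic_chain s \<kappa> h \<longleftrightarrow>
     (\<forall>l<s. L2_primitive (h l) (\<lambda>x. h (Suc l) x - \<kappa> * h l x) \<and> h l 0 = h l 1)"

lemma periodic_chain_L2:
  assumes c: "periodic_chain s \<kappa> h" and s: "s \<ge> 1" and l: "l \<le> s"
  shows "L2_on {0..1} (h l)"
proof (cases "l < s")
  case True
  then show ?thesis
    using c L2_primitive_continuous L2_on_continuous by (auto simp: periodic_chain_def)
next
  case False
  with s l obtain r where r: "s = Suc r" "l = Suc r" by (cases s) auto
  have "L2_primitive (h r) (\<lambda>x. h (Suc r) x - \<kappa> * h r x)"
    using c r by (auto simp: periodic_chain_def)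
  then have "L2_on {0..1} (\<lambda>x. (h (Suc r) x - \<kappa> * h r x) + \<kappa> * h r x)"
    by (intro L2_on_add L2_on_cmult L2_on_continuous L2_primitive_continuous L2_primitive_L2) auto
  then show ?thesis using r by simp
qed

text \<open>The derivative of a periodic function has mean zero.\<close>

lemma periodic_chain_integral_Suc:
  assumes c: "periodic_chain s \<kappa> h" and l: "l < s"
  shows "integral {0..1} (h (Suc l)) = \<kappa> * integral {0..1} (h l)"
proof -
  have p: "L2_primitive (h l) (\<lambda>x. h (Suc l) x - \<kappa> * h l x)" and per: "h l 0 = h l 1"
    using c l by (auto simp: periodic_chain_def)
  have hi: "h l integrable_on {0..1}"
    by (intro integrable_continuous_interval L2_primitive_continuous[OF p])
  have "((\<lambda>x. (h (Suc l) x - \<kappa> * h l x) + \<kappa> * h l x) has_integral (h l 1 - h l 0) + \<kappa> * integral {0..1} (h l)) {0..1}"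
    by (intro has_integral_add has_integral_mult_right integrable_integral hi L2_primitiveD[OF p]) auto
  then show ?thesis using per by (simp add: integral_unique)
qed

lemma periodic_chain_integral_bound:
  assumes c: "periodic_chain s \<kappa> h" and s: "s \<ge> 1"
  shows "cmod \<kappa> ^ s * cmod (integral {0..1} (h 0)) \<le> L2_norm {0..1} (h s)"
proof -
  have iter: "integral {0..1} (h l) = \<kappa> ^ l * integral {0..1} (h 0)" if "l \<le> s" for l
    using that by (induction l) (auto simp: periodic_chain_integral_Suc[OF c] mult.assoc)
  have "cmod \<kappa> ^ s * cmod (integral {0..1} (h 0)) = cmod (integral {0..1} (h s))"
    unfolding iter[OF order_refl] by (simp add: norm_mult norm_power)
  also have "\<dots> = sqrt ((cmod (integral {0..1} (h s)))\<^sup>2)" by simp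
  also have "\<dots> \<le> L2_norm {0..1} (h s)"
    unfolding L2_norm_def
    using cmod_integral_square_le[OF periodic_chain_L2[OF c s order_refl]]
    by (intro real_sqrt_le_mono) simp
  finally show ?thesis .
qed

text \<open>Let \<open>V l\<close> be the average of \<open>h l\<close> over the cells, minus its mean. The error of the rectangle rule
  is \<open>V 0\<close> at the point 0, up to sign, and \<open>V (l + 1) = m V l' + \<kappa> V l\<close>. By the Wirtinger inequality
  \<open>\<parallel>V (l + 1)\<parallel> \<ge> (2 \<pi> m - |\<kappa>|) \<parallel>V l\<parallel>\<close>, so each of the \<open>s\<close> steps gains a factor
  \<open>2 \<pi> (m - q)\<close>. The first step passes from a point value to a norm; it costs the additional
  factor \<open>2 \<pi> / \<surd>12 \<le> 2\<close>.\<close>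

lemma periodic_chain_aliasing_bound:
  assumes c: "periodic_chain s \<kappa> h" and s: "s \<ge> 1" and m: "m > 0"
    and \<kappa>: "cmod \<kappa> = 2 * pi * q" and q: "0 \<le> q" "q < real m"
  shows "cmod (integral {0..1} (h 0) - fold_period m (h 0) 0)
    \<le> 2 * (L2_norm {0..1} (h s) / (2 * pi * (real m - q)) ^ s)"
proof -
  define V where "V l t = fold_period m (h l) t - integral {0..1} (h l)" for l t
  define d where "d = real m - q"
  have d: "d > 0" using q by (simp add: d_def)
  let ?N = "\<lambda>l. L2_norm {0..1} (V l)"
  have L2h: "L2_on {0..1} (h l)" if "l \<le> s" for l
    using periodic_chain_L2[OF c s that] .
  have L2V: "L2_on {0..1} (V l)" if "l \<le> s" for l
    unfolding V_def by (intro L2_on_diff L2_on_fold_period L2_on_continuous L2h that) auto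
  have pV: "L2_primitive (V l) (\<lambda>t. (V (Suc l) t - \<kappa> * V l t) / of_nat m)"
    and perV: "V l 0 = V l 1" and meanV: "integral {0..1} (V l) = 0" if l: "l < s" for l
  proof -
    have p: "L2_primitive (h l) (\<lambda>x. h (Suc l) x - \<kappa> * h l x)" and per: "h l 0 = h l 1"
      using c l by (auto simp: periodic_chain_def)
    have "L2_primitive (\<lambda>t. fold_period m (h l) t - integral {0..1} (h l))
       (\<lambda>t. fold_period m (\<lambda>x. h (Suc l) x - \<kappa> * h l x) t / of_nat m - 0)"
      by (intro L2_primitive_diff L2_primitive_fold_period m p L2_primitive_const)
    moreover have "fold_period m (\<lambda>x. h (Suc l) x - \<kappa> * h l x) t = V (Suc l) t - \<kappa> * V l t" for t
      by (simp add: V_def fold_period_def sum_subtractf sum_distrib_left[symmetric] diff_divide_distrib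
          right_diff_distrib periodic_chain_integral_Suc[OF c l])
    ultimately show "L2_primitive (V l) (\<lambda>t. (V (Suc l) t - \<kappa> * V l t) / of_nat m)"
      by (simp add: V_def[abs_def])
    show "V l 0 = V l 1" using fold_period_periodic[OF per m] by (simp add: V_def)
    have hi: "h l integrable_on {0..1}"
      by (intro integrable_continuous_interval L2_primitive_continuous[OF p])
    have "((\<lambda>t. fold_period m (h l) t - integral {0..1} (h l)) has_integral
        integral {0..1} (h l) - integral {0..1} (h l)) {0..1}"
      using has_integral_const_real[of "integral {0..1} (h l)" 0 1]
      by (intro has_integral_diff integral_fold_period m hi) simp
    then show "integral {0..1} (V l) = 0" by (simp add: V_def[abs_def] integral_unique)
  qed
  \<comment> \<open>The triangle inequality for \<open>m V l' = V (l + 1) - \<kappa> V l\<close>.\<close>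
  have up: "m * L2_norm {0..1} (\<lambda>t. (V (Suc l) t - \<kappa> * V l t) / of_nat m) \<le> ?N (Suc l) + 2 * pi * q * ?N l"
    if l: "l < s" for l
  proof -
    have "m * L2_norm {0..1} (\<lambda>t. (V (Suc l) t - \<kappa> * V l t) / of_nat m)
        = L2_norm {0..1} (\<lambda>t. V (Suc l) t + (- \<kappa>) * V l t)"
      using L2_norm_cmult[of "{0..1}" "of_nat m" "\<lambda>t. (V (Suc l) t - \<kappa> * V l t) / of_nat m"] m by simp
    also have "\<dots> \<le> ?N (Suc l) + L2_norm {0..1} (\<lambda>t. (- \<kappa>) * V l t)"
      using l by (intro L2_norm_triangle L2V L2_on_cmult) auto
    also have "L2_norm {0..1} (\<lambda>t. (- \<kappa>) * V l t) = 2 * pi * q * ?N l"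
      by (simp only: L2_norm_cmult norm_minus_cancel \<kappa>)
    finally show ?thesis .
  qed
  have step: "2 * pi * d * ?N l \<le> ?N (Suc l)" if l: "l < s" for l
  proof -
    have "m * (2 * pi * ?N l) \<le> m * L2_norm {0..1} (\<lambda>t. (V (Suc l) t - \<kappa> * V l t) / of_nat m)"
      by (intro mult_left_mono Wirtinger[OF pV[OF l] perV[OF l] meanV[OF l]]) simp
    with up[OF l] show ?thesis by (simp add: d_def algebra_simps)
  qed
  have iter: "(2 * pi * d) ^ l * ?N 1 \<le> ?N (Suc l)" if "Suc l \<le> s" for l
    using that
  proof (induction l)
    case (Suc l)
    have "(2 * pi * d) ^ Suc l * ?N 1 = 2 * pi * d * ((2 * pi * d) ^ l * ?N 1)" by simp
    also have "\<dots> \<le> 2 * pi * d * ?N (Suc l)"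
      using Suc d by (intro mult_left_mono) auto
    also have "\<dots> \<le> ?N (Suc (Suc l))" using step[of "Suc l"] Suc by simp
    finally show ?case .
  qed simp
  have s0: "0 < s" using s by simp
  \<comment> \<open>\<open>D\<close> is the norm of the derivative of \<open>V 0\<close>, which controls the value of \<open>V 0\<close> at the point 0.\<close>
  define D where "D = L2_norm {0..1} (\<lambda>t. (V (Suc 0) t - \<kappa> * V 0 t) / of_nat m)"
  have "2 * pi * d * (m * D) \<le> 2 * pi * d * (?N 1 + 2 * pi * q * ?N 0)"
    using up[OF s0] d unfolding D_def by (intro mult_left_mono) auto
  also have "\<dots> = 2 * pi * d * ?N 1 + 2 * pi * q * (2 * pi * d * ?N 0)" by (simp add: algebra_simps)
  also have "\<dots> \<le> 2 * pi * d * ?N 1 + 2 * pi * q * ?N 1"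
    using step[OF s0] q by (intro add_left_mono mult_left_mono) auto
  also have "\<dots> = 2 * pi * m * ?N 1" by (simp add: d_def algebra_simps)
  finally have "d * D \<le> ?N 1"
    using m by (simp add: mult.assoc mult.left_commute[of _ "real m"])
  have "integral {0..1} (h 0) - fold_period m (h 0) 0 = - V 0 0" by (simp add: V_def)
  then have "cmod (integral {0..1} (h 0) - fold_period m (h 0) 0) \<le> D / sqrt 12"
    using periodic_mean_zero_endpoint_bound[OF pV[OF s0] perV[OF s0] meanV[OF s0]]
    by (simp add: D_def)
  then have "(2 * pi * d) ^ s * cmod (integral {0..1} (h 0) - fold_period m (h 0) 0) \<le> (2 * pi * d) ^ s * (D / sqrt 12)"
    using d by (intro mult_left_mono) auto
  also have "\<dots> = (2 * pi / sqrt 12) * ((2 * pi * d) ^ (s - 1) * (d * D))"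
    using s0 by (cases s) (auto simp: field_simps)
  also have "\<dots> \<le> (2 * pi / sqrt 12) * ((2 * pi * d) ^ (s - 1) * ?N 1)"
    using d \<open>d * D \<le> ?N 1\<close> by (intro mult_left_mono) auto
  also have "\<dots> \<le> (2 * pi / sqrt 12) * ?N s"
    using iter[of "s - 1"] s0 by (intro mult_left_mono) auto
  also have "\<dots> \<le> 2 * ?N s"
  proof (rule mult_right_mono)
    have "pi \<le> sqrt 12" by (rule pi_le_sqrt_12)
    then show "2 * pi / sqrt 12 \<le> 2" by (subst pos_divide_le_eq) auto
  qed simp
  also have "?N s \<le> L2_norm {0..1} (h s)"
  proof -
    have L2f: "L2_on {0..1} (fold_period m (h s))" by (intro L2_on_fold_period L2h) simp
    have "h s integrable_on {0..1}"
      using L2_on_absolutely_integrable[OF L2h[OF order_refl]] by (simp add: absolutely_integrable_on_def)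
    then have "integral {0..1} (fold_period m (h s)) = integral {0..1} (h s)"
      using integral_fold_period[OF m] by (intro integral_unique) auto
    then have "?N s \<le> L2_norm {0..1} (fold_period m (h s))"
      using L2_norm_minus_mean_le[OF L2f] by (simp add: V_def[abs_def])
    also have "\<dots> \<le> L2_norm {0..1} (h s)" by (rule L2_norm_fold_period_le[OF m L2h]) simp
    finally show ?thesis .
  qed
  finally show ?thesis
    using d by (simp add: d_def field_simps)
qed

section \<open>Sobolev functions\<close>

lemma nderiv_0 [simp]: "nderiv 0 f = f"
  by (simp add: nderiv_def)

lemma nderiv_Suc: "nderiv (Suc l) f x = vector_derivative (nderiv l f) (at x within {0..1})"
  by (simp add: nderiv_def)

lemma abs_continuous_on_imp_continuous_on:
  assumes f: "abs_continuous_on {a..b::real} f"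
  shows "continuous_on {a..b} f"
proof -
  have *: "\<exists>\<delta>>0. \<forall>x y. a \<le> x \<and> x \<le> y \<and> y \<le> b \<and> y - x < \<delta> \<longrightarrow> dist (f x) (f y) < e" if e: "e > 0" for e
  proof -
    from f[unfolded abs_continuous_on_def, rule_format, OF e]
    obtain \<delta> where \<delta>: "\<delta> > 0" and small: "\<forall>(m::nat) l r.
        (\<forall>i<m. l i \<le> r i \<and> {l i..r i} \<subseteq> {a..b}) \<and> disjoint_family_on (\<lambda>i. {l i<..<r i}) {..<m} \<and>
        (\<Sum>i<m. r i - l i) < \<delta> \<longrightarrow> (\<Sum>i<m. dist (f (l i)) (f (r i))) < e"
      by (elim exE conjE)
    have "dist (f x) (f y) < e" if "a \<le> x" "x \<le> y" "y \<le> b" "y - x < \<delta>" for x y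
      using small[THEN spec, of "Suc 0", THEN spec, of "\<lambda>_. x", THEN spec, of "\<lambda>_. y"] that
      by (simp add: disjoint_family_on_def)
    with \<delta> show ?thesis by blast
  qed
  show ?thesis
    unfolding continuous_on_iff
  proof (intro ballI allI impI)
    fix x e :: real assume x: "x \<in> {a..b}" and e: "e > 0"
    obtain \<delta> where \<delta>: "\<delta> > 0" "\<And>x y. a \<le> x \<and> x \<le> y \<and> y \<le> b \<and> y - x < \<delta> \<longrightarrow> dist (f x) (f y) < e"
      using *[OF e] by blast
    have "dist (f y) (f x) < e" if "y \<in> {a..b}" "dist y x < \<delta>" for y
      using \<delta>(2)[of x y] \<delta>(2)[of y x] that x by (cases "x \<le> y") (auto simp: dist_real_def dist_commute)
    with \<delta>(1) show "\<exists>d>0. \<forall>x'\<in>{a..b}. dist x' x < d \<longrightarrow> dist (f x') (f x) < e" by blast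
  qed
qed

lemma square_integrable_imp_L2_on:
  assumes "square_integrable g"
  shows "L2_on {0..1} g"
proof -
  have "g \<in> borel_measurable (lebesgue_on {0..1})"
    using assms by (simp add: square_integrable_def set_borel_measurable_def borel_measurable_restrict_space_iff)
  moreover have "(\<lambda>x. (cmod (g x))\<^sup>2) integrable_on {0..1}"
    using assms by (intro set_lebesgue_integral_eq_integral) (simp add: square_integrable_def)
  ultimately show ?thesis by (simp add: L2_on_def)
qed

lemma sobolev_has_vector_derivative:
  assumes f: "f \<in> sobolev s" and l: "l < s - 1" and x: "x \<in> {0..1}"
  shows "(nderiv l f has_vector_derivative nderiv (Suc l) f x) (at x within {0..1})"
  using f l x unfolding nderiv_Suc sobolev_def by (auto simp: vector_derivative_works)

lemma sobolev_continuous: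
  assumes f: "f \<in> sobolev s" and l: "l < s"
  shows "continuous_on {0..1} (nderiv l f)"
proof (cases "l < s - 1")
  case True
  then show ?thesis
    unfolding continuous_on_eq_continuous_within
    by (intro ballI has_vector_derivative_continuous[OF sobolev_has_vector_derivative[OF f True]])
next
  case False
  with l have "l = s - 1" by simp
  then have "abs_continuous_on {0..1} (nderiv l f)" using f by (simp add: sobolev_def)
  then show ?thesis by (rule abs_continuous_on_imp_continuous_on)
qed

text \<open>Below the top order the derivatives are classical; at the top order this is the fundamental
  theorem for absolutely continuous functions.\<close>

lemma sobolev_L2_primitive:
  assumes f: "f \<in> sobolev s" and l: "l < s"
  shows "L2_primitive (nderiv l f) (nderiv (Suc l) f)"
proof (cases "l < s - 1")
  case True
  then show ?thesis
    by (intro L2_primitive_C1 sobolev_has_vector_derivative[OF f] sobolev_continuous[OF f]) auto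
next
  case False
  with l have ls: "Suc l = s" "s - 1 = l" by auto
  have AC: "abs_continuous_on {0..1} (nderiv l f)"
    and AE: "AE x in lebesgue. x \<in> {0..1} \<longrightarrow> nderiv l f differentiable (at x within {0..1})"
    and sq: "square_integrable (nderiv (Suc l) f)"
    using f ls by (auto simp: sobolev_def)
  obtain N where N: "N \<in> null_sets lebesgue"
    and bad: "{x \<in> space lebesgue. \<not> (x \<in> {0..1} \<longrightarrow> nderiv l f differentiable (at x within {0..1}))} \<subseteq> N"
    using AE unfolding eventually_ae_filter by blast
  have d: "(nderiv l f has_vector_derivative nderiv (Suc l) f x) (at x within {0..1})" if "x \<in> {0..1} - N" for x
    using bad that unfolding nderiv_Suc by (auto simp flip: vector_derivative_works)
  show ?thesis
    unfolding L2_primitive_def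
  proof (intro conjI allI impI)
    show "L2_on {0..1} (nderiv (Suc l) f)" by (rule square_integrable_imp_L2_on[OF sq])
    fix a b :: real assume ab: "0 \<le> a" "a \<le> b" "b \<le> 1"
    show "(nderiv (Suc l) f has_integral nderiv l f b - nderiv l f a) {a..b}"
    proof (rule abs_continuous_FTC[OF AC _ ab(2)])
      show "negligible N" using N by (simp add: negligible_iff_null_sets)
      show "(nderiv l f has_vector_derivative nderiv (Suc l) f x) (at x within {a..b})" if "x \<in> {a..b} - N" for x
        using that ab by (intro has_vector_derivative_within_subset[OF d]) auto
    qed (use ab in auto)
  qed
qed

lemma sobolev_norm_sq:
  assumes f: "f \<in> sobolev s" and s: "s \<ge> 1"
  shows "Re (sobolev_inner s f f) = (\<Sum>l<s. (cmod (integral {0..1} (nderiv l f)))\<^sup>2) + (L2_norm {0..1} (nderiv s f))\<^sup>2"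
proof -
  have int: "(LINT x:{0..1}|lebesgue. nderiv l f x) = integral {0..1} (nderiv l f)" if "l < s" for l
    by (intro set_lebesgue_integral_eq_integral absolutely_integrable_continuous_real sobolev_continuous[OF f that])
  have cnj: "(LINT x:{0..1}|lebesgue. cnj (nderiv l f x)) = cnj (LINT x:{0..1}|lebesgue. nderiv l f x)" for l
    unfolding set_lebesgue_integral_def by (simp flip: complex_cnj_scaleR)
  have sq: "square_integrable (nderiv s f)" using f by (simp add: sobolev_def)
  have "(LINT x:{0..1}|lebesgue. nderiv s f x * cnj (nderiv s f x))
      = (LINT x:{0..1}|lebesgue. complex_of_real ((cmod (nderiv s f x))\<^sup>2))"
    by (simp only: complex_norm_square)
  also have "\<dots> = complex_of_real (LINT x:{0..1}|lebesgue. (cmod (nderiv s f x))\<^sup>2)"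
    by (rule set_integral_complex_of_real)
  also have "\<dots> = complex_of_real ((L2_norm {0..1} (nderiv s f))\<^sup>2)"
    using sq unfolding L2_norm_sq square_integrable_def by (simp add: set_lebesgue_integral_eq_integral)
  finally have top: "(LINT x:{0..1}|lebesgue. nderiv s f x * cnj (nderiv s f x))
      = complex_of_real ((L2_norm {0..1} (nderiv s f))\<^sup>2)" .
  have "(\<Sum>l<s. (LINT x:{0..1}|lebesgue. nderiv l f x) * (LINT x:{0..1}|lebesgue. cnj (nderiv l f x)))
      = complex_of_real (\<Sum>l<s. (cmod (integral {0..1} (nderiv l f)))\<^sup>2)"
    unfolding cnj of_real_sum by (intro sum.cong refl) (simp add: int complex_norm_square del: of_real_power)
  then show ?thesis unfolding sobolev_inner_def top by simp
qed

lemma osc_integral_eq_integral: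
  assumes "continuous_on {0..1} f"
  shows "osc_integral k f = integral {0..1} (\<lambda>x. f x * exp (- 2 * of_real pi * \<i> * of_int k * of_real x))"
  unfolding osc_integral_def
  by (intro set_lebesgue_integral_eq_integral absolutely_integrable_continuous_real continuous_intros assms)

section \<open>Periodization by Bernoulli polynomials\<close>

text \<open>On the unit interval this is \<open>B\<^sub>r(x) / r!\<close> with the Bernoulli polynomial \<open>B\<^sub>r\<close>: each function is the
  primitive of mean zero of the preceding one.\<close>

primrec bernoulli_fun :: "nat \<Rightarrow> real \<Rightarrow> complex" where
  "bernoulli_fun 0 = (\<lambda>_. 1)"
| "bernoulli_fun (Suc r) = (\<lambda>x. integral {0..x} (bernoulli_fun r)
     - integral {0..1} (\<lambda>y. integral {0..y} (bernoulli_fun r)))"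

lemma bernoulli_fun_continuous: "continuous_on {0..1} (bernoulli_fun r)"
proof (induction r)
  case (Suc r)
  then show ?case
    by (auto intro!: continuous_intros indefinite_integral_continuous_1 integrable_continuous_interval)
qed simp

lemma bernoulli_fun_L2_primitive: "L2_primitive (bernoulli_fun (Suc r)) (bernoulli_fun r)"
proof (rule L2_primitive_C1[OF _ bernoulli_fun_continuous])
  fix x :: real assume "x \<in> {0..1}"
  then have "((\<lambda>x. integral {0..x} (bernoulli_fun r) - integral {0..1} (\<lambda>y. integral {0..y} (bernoulli_fun r)))
      has_vector_derivative bernoulli_fun r x - 0) (at x within {0..1})"
    by (intro has_vector_derivative_diff integral_has_vector_derivative bernoulli_fun_continuous
        has_vector_derivative_const)
  then show "(bernoulli_fun (Suc r) has_vector_derivative bernoulli_fun r x) (at x within {0..1})"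
    by simp
qed

text \<open>The jump is the integral of the preceding function, which has mean zero unless it is the
  constant 1.\<close>

lemma bernoulli_fun_jump: "bernoulli_fun (Suc r) 1 - bernoulli_fun (Suc r) 0 = (if r = 0 then 1 else 0)"
proof (cases r)
  case (Suc q)
  define P where "P y = integral {0..y} (bernoulli_fun q)" for y
  have "continuous_on {0..1} P"
    unfolding P_def
    by (intro indefinite_integral_continuous_1 integrable_continuous_interval bernoulli_fun_continuous)
  then have "((\<lambda>x. P x - integral {0..1} P) has_integral integral {0..1} P - integral {0..1} P) {0..1}"
    using has_integral_const_real[of "integral {0..1} P" 0 1]
    by (intro has_integral_diff integrable_integral integrable_continuous_interval) auto
  then have "integral {0..1} (bernoulli_fun r) = 0"
    by (simp add: Suc P_def[abs_def] integral_unique)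
  then show ?thesis using Suc by simp
qed simp

text \<open>The \<open>l\<close>-th derivative of \<open>B\<^sub>i\<^sub>+\<^sub>1 / (i + 1)!\<close>. Among its derivatives of every order, that of order
  \<open>i\<close> alone has different values at the two end points.\<close>

definition jump_corrector :: "nat \<Rightarrow> nat \<Rightarrow> real \<Rightarrow> complex" where
  "jump_corrector i l = (if l \<le> Suc i then bernoulli_fun (Suc i - l) else (\<lambda>_. 0))"

lemma jump_corrector_L2_primitive: "L2_primitive (jump_corrector i l) (jump_corrector i (Suc l))"
proof (cases "l \<le> i")
  case True
  then have "Suc i - l = Suc (i - l)" by simp
  then show ?thesis using True bernoulli_fun_L2_primitive[of "i - l"] by (simp add: jump_corrector_def)
next
  case False
  then show ?thesis
    using L2_primitive_const[of 1] L2_primitive_const[of 0] by (simp add: jump_corrector_def)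
qed

lemma jump_corrector_jump: "jump_corrector i l 1 - jump_corrector i l 0 = (if l = i then 1 else 0)"
proof (cases "l \<le> i")
  case True
  then have "Suc i - l = Suc (i - l)" by simp
  then show ?thesis using True bernoulli_fun_jump[of "i - l"] by (auto simp: jump_corrector_def)
qed (auto simp: jump_corrector_def)

lemma jump_corrector_top: "i < s \<Longrightarrow> jump_corrector i s x = (if Suc i = s then 1 else 0)"
  by (auto simp: jump_corrector_def)

definition periodized :: "nat \<Rightarrow> (real \<Rightarrow> complex) \<Rightarrow> nat \<Rightarrow> real \<Rightarrow> complex" where
  "periodized s f l x = nderiv l f x - (\<Sum>i<s. (nderiv i f 1 - nderiv i f 0) * jump_corrector i l x)"

lemma periodized_L2_primitive:
  assumes "f \<in> sobolev s" "l < s"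
  shows "L2_primitive (periodized s f l) (periodized s f (Suc l))"
  unfolding periodized_def[abs_def]
  by (intro L2_primitive_diff L2_primitive_sum L2_primitive_cmult sobolev_L2_primitive[OF assms]
      jump_corrector_L2_primitive)

lemma periodized_periodic:
  assumes "l < s"
  shows "periodized s f l 0 = periodized s f l 1"
proof -
  have "periodized s f l 1 - periodized s f l 0 = (nderiv l f 1 - nderiv l f 0)
     - (\<Sum>i<s. (nderiv i f 1 - nderiv i f 0) * (jump_corrector i l 1 - jump_corrector i l 0))"
    unfolding periodized_def right_diff_distrib sum_subtractf by simp
  also have "\<dots> = 0"
    using assms unfolding jump_corrector_jump by (simp add: if_distrib[of "\<lambda>x. _ * x"] sum.delta cong: if_cong)
  finally show ?thesis by simp
qed

text \<open>At order \<open>s\<close> only the corrector of index \<open>s - 1\<close> survives, as the constant 1. Its coefficient, the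
  jump of the derivative of order \<open>s - 1\<close>, is the mean of the derivative of order \<open>s\<close>.\<close>

lemma periodized_top_norm_le:
  assumes f: "f \<in> sobolev s" and s: "s \<ge> 1"
  shows "L2_norm {0..1} (periodized s f s) \<le> L2_norm {0..1} (nderiv s f)"
proof -
  obtain r where r: "s = Suc r" using s by (cases s) auto
  have p: "L2_primitive (nderiv r f) (nderiv s f)"
    using sobolev_L2_primitive[OF f, of r] r by simp
  have "periodized s f s x = nderiv s f x - integral {0..1} (nderiv s f)" for x
  proof -
    have "(\<Sum>i<s. (nderiv i f 1 - nderiv i f 0) * jump_corrector i s x)
        = (\<Sum>i<s. if i = r then nderiv i f 1 - nderiv i f 0 else 0)"
      by (intro sum.cong refl) (auto simp: jump_corrector_top r)
    also have "\<dots> = nderiv r f 1 - nderiv r f 0" using r by simp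
    also have "\<dots> = integral {0..1} (nderiv s f)"
      using L2_primitiveD[OF p, of 0 1] by (simp add: integral_unique)
    finally show ?thesis by (simp add: periodized_def)
  qed
  then have "periodized s f s = (\<lambda>x. nderiv s f x - integral {0..1} (nderiv s f))" by blast
  then show ?thesis using L2_norm_minus_mean_le[OF L2_primitive_L2[OF p]] by simp
qed

section \<open>Modulation\<close>

definition osc :: "int \<Rightarrow> real \<Rightarrow> complex" where
  "osc k x = exp (- 2 * of_real pi * \<i> * of_int k * of_real x)"

lemma osc_deriv:
  "(osc k has_vector_derivative - (2 * of_real pi * \<i> * of_int k) * osc k x) (at x within S)"
proof -
  define c where "c = - (2 * complex_of_real pi * \<i> * of_int k)"
  have "((\<lambda>z. exp (c * z)) has_field_derivative c * exp (c * of_real x)) (at (of_real x))"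
    by (auto intro!: derivative_eq_intros)
  from has_vector_derivative_at_within[OF has_vector_derivative_real_field[OF this]]
  have "((\<lambda>x. exp (c * of_real x)) has_vector_derivative c * exp (c * of_real x)) (at x within S)" .
  moreover have "osc k = (\<lambda>x. exp (c * of_real x))"
    by (simp add: osc_def[abs_def] c_def)
  ultimately show ?thesis by (simp add: c_def)
qed

lemma osc_continuous: "continuous_on S (osc k)"
  unfolding osc_def[abs_def] by (intro continuous_intros)

lemma cmod_osc [simp]: "cmod (osc k x) = 1"
  by (simp add: osc_def norm_exp_eq_Re)

lemma osc_0 [simp]: "osc k 0 = 1" and osc_1 [simp]: "osc k 1 = 1"
proof -
  show "osc k 0 = 1" by (simp add: osc_def)
  show "osc k 1 = 1"
    unfolding osc_def exp_eq_1 by (auto intro!: exI[of _ "- k"])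
qed

lemma periodic_chain_periodized:
  assumes f: "f \<in> sobolev s"
  shows "periodic_chain s (2 * of_real pi * \<i> * of_int k) (\<lambda>l x. periodized s f l x * osc k x)"
  unfolding periodic_chain_def
proof (intro allI impI conjI)
  fix l assume l: "l < s"
  have "L2_primitive (\<lambda>x. periodized s f l x * osc k x)
     (\<lambda>x. periodized s f (Suc l) x * osc k x + periodized s f l x * (- (2 * of_real pi * \<i> * of_int k) * osc k x))"
    by (intro L2_primitive_mult periodized_L2_primitive[OF f l] osc_deriv continuous_intros osc_continuous)
  then show "L2_primitive (\<lambda>x. periodized s f l x * osc k x)
     (\<lambda>x. periodized s f (Suc l) x * osc k x - 2 * of_real pi * \<i> * of_int k * (periodized s f l x * osc k x))"
    by (rule L2_primitive_cong) (simp_all add: algebra_simps)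
  show "periodized s f l 0 * osc k 0 = periodized s f l 1 * osc k 1"
    using periodized_periodic[OF l] by simp
qed

section \<open>The upper bound\<close>

lemma algorithms_sum:
  assumes "\<And>i. i < n \<Longrightarrow> l i < s \<and> x i \<in> {0..1}"
  shows "(\<lambda>f. \<Sum>i<n. a i * nderiv (l i) f (x i)) \<in> algorithms n s"
  unfolding algorithms_def mem_Collect_eq
proof (intro exI conjI ballI)
  show "(\<lambda>f. \<Sum>i<n. a i * nderiv (l i) f (x i))
      = (\<lambda>f. \<Sum>j=1..n. a (j - 1) * nderiv (l (j - 1)) f (x (j - 1)))"
    by (simp add: sum.atLeast1_atMost_eq)
qed (use assms in auto)

lemma algorithms_add:
  assumes "A \<in> algorithms n s" "B \<in> algorithms m s"
  shows "(\<lambda>f. A f + B f) \<in> algorithms (n + m) s"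
proof -
  from assms(1) obtain a l x where A: "\<forall>j\<in>{1..n}. l j < s \<and> x j \<in> {0..1}"
    "A = (\<lambda>f. \<Sum>j=1..n. a j * nderiv (l j) f (x j))"
    unfolding algorithms_def mem_Collect_eq by (elim exE conjE)
  from assms(2) obtain b l' y where B: "\<forall>j\<in>{1..m}. l' j < s \<and> y j \<in> {0..1}"
    "B = (\<lambda>f. \<Sum>j=1..m. b j * nderiv (l' j) f (y j))"
    unfolding algorithms_def mem_Collect_eq by (elim exE conjE)
  define a2 where "a2 j = (if j \<le> n then a j else b (j - n))" for j
  define l2 where "l2 j = (if j \<le> n then l j else l' (j - n))" for j
  define x2 where "x2 j = (if j \<le> n then x j else y (j - n))" for j
  show ?thesis
    unfolding algorithms_def mem_Collect_eq
  proof (intro exI conjI ballI)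
    fix j assume "j \<in> {1..n + m}"
    then show "l2 j < s" "x2 j \<in> {0..1}"
      using bspec[OF A(1), of j] bspec[OF B(1), of "j - n"] by (auto simp: l2_def x2_def Suc_le_eq)
  next
    have "A f + B f = (\<Sum>j=1..n + m. a2 j * nderiv (l2 j) f (x2 j))" for f
    proof -
      have "(\<Sum>j=1..n + m. a2 j * nderiv (l2 j) f (x2 j))
          = (\<Sum>j=1..n. a2 j * nderiv (l2 j) f (x2 j)) + (\<Sum>j=n+1..n + m. a2 j * nderiv (l2 j) f (x2 j))"
        by (rule sum.ub_add_nat) simp
      also have "(\<Sum>j=n+1..n + m. a2 j * nderiv (l2 j) f (x2 j))
          = (\<Sum>j=1..m. a2 (j + n) * nderiv (l2 (j + n)) f (x2 (j + n)))"
        using sum.shift_bounds_cl_nat_ivl[of "\<lambda>j. a2 j * nderiv (l2 j) f (x2 j)" 1 n m]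
        by (simp add: add.commute)
      also have "\<dots> = B f"
        unfolding B(2) by (intro sum.cong refl) (auto simp: a2_def l2_def x2_def)
      also have "(\<Sum>j=1..n. a2 j * nderiv (l2 j) f (x2 j)) = A f"
        unfolding A(2) by (intro sum.cong refl) (auto simp: a2_def l2_def x2_def)
      finally show ?thesis by simp
    qed
    then show "(\<lambda>f. A f + B f) = (\<lambda>f. \<Sum>j=1..n + m. a2 j * nderiv (l2 j) f (x2 j))" by blast
  qed
qed

text \<open>With \<open>X = m + |k|\<close>, the hypothesis holds for \<open>y = |k|\<close> if \<open>m \<le> 2 |k|\<close> and for
  \<open>y = m - |k|\<close> otherwise.\<close>

lemma rate_bound:
  fixes X y :: real
  assumes "0 < X" "X \<le> 3 * y"
  shows "1 / (2 * pi * y) ^ s \<le> (3 / (2 * pi)) ^ s * (1 / X ^ s)"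
proof -
  have y: "y > 0" using assms by linarith
  have "1 / (2 * pi * y) \<le> 3 / (2 * pi) * (1 / X)"
    using assms y by (simp add: field_simps)
  then have "(1 / (2 * pi * y)) ^ s \<le> (3 / (2 * pi) * (1 / X)) ^ s"
    using y by (intro power_mono) auto
  then show ?thesis by (simp add: power_mult_distrib power_divide)
qed

text \<open>The algorithm applies a rule \<open>R\<close>, either zero or the rectangle rule for the modulated function, and
  adds the errors that \<open>R\<close> makes on the Bernoulli polynomials, weighted with the jumps of \<open>f\<close>. Its
  error on \<open>f\<close> is therefore the error of \<open>R\<close> on the periodized function.\<close>

lemma min_error_upper_bound:
  assumes s: "s \<ge> 1" and n: "n \<ge> 2 * s"
  shows "min_error n k s \<le>
    ereal ((3 / (2 * pi)) ^ s * (2 / (real n + \<bar>real_of_int k\<bar> - 2 * real s + 1) ^ s))"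
proof -
  define m where "m = n - 2 * s + 1"
  define q where "q = \<bar>real_of_int k\<bar>"
  have m: "m > 0" and mn: "n = s + s + (m - 1)" using n by (auto simp: m_def)
  have X: "real n + \<bar>real_of_int k\<bar> - 2 * real s + 1 = real m + q"
    using n by (simp add: m_def q_def of_nat_diff)
  \<comment> \<open>The common weight of the nodes; it vanishes when the frequency is too high for the grid.\<close>
  define w :: complex where "w = (if 2 * q < m then 1 / of_nat m else 0)"
  define R where "R u = w * (\<Sum>i<m. u (real i / m) * osc k (real i / m))" for u
  define T where "T u = integral {0..1} (\<lambda>x. u x * osc k x) - R u" for u
  \<comment> \<open>The node 0 of the rectangle rule is merged with the data at the left end point, so that the
    three sums use \<open>s\<close>, \<open>s\<close> and \<open>m - 1\<close> pieces of data.\<close>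
  define A where "A f = (\<Sum>i<s. ((if i = 0 then w else 0) - T (jump_corrector i 0)) * nderiv i f 0)
      + (\<Sum>i<s. T (jump_corrector i 0) * nderiv i f 1)
      + (\<Sum>i<m - 1. (w * osc k (real (Suc i) / m)) * nderiv 0 f (real (Suc i) / m))" for f
  have alg: "A \<in> algorithms n s"
    unfolding A_def[abs_def] mn
    by (intro algorithms_add algorithms_sum) (use s in auto)
  have A_eq: "A f = R f + (\<Sum>i<s. (nderiv i f 1 - nderiv i f 0) * T (jump_corrector i 0))" for f
  proof -
    obtain r where r: "s = Suc r" using s by (cases s) auto
    have "(\<Sum>i<s. (if i = 0 then w else 0) * nderiv i f 0) = w * f 0"
      unfolding r sum.lessThan_Suc_shift by simp
    moreover obtain p where p: "m = Suc p" using m by (cases m) auto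
    have "R f = w * f 0 + (\<Sum>i<m - 1. (w * osc k (real (Suc i) / m)) * nderiv 0 f (real (Suc i) / m))"
      unfolding R_def by (simp add: p sum.lessThan_Suc_shift sum_distrib_left algebra_simps del: of_nat_Suc sum.lessThan_Suc)
    ultimately show ?thesis
      by (simp add: A_def left_diff_distrib right_diff_distrib sum_subtractf mult.commute)
  qed
  have err: "cmod (osc_integral k f - A f) \<le> (3 / (2 * pi)) ^ s * (2 / (real m + q) ^ s)"
    if f: "f \<in> sobolev s" and nf: "sobolev_norm s f \<le> 1" for f
  proof -
    have "Re (sobolev_inner s f f) \<le> 1" using nf by (simp add: sobolev_norm_def)
    then have "(L2_norm {0..1} (nderiv s f))\<^sup>2 \<le> 1"
      unfolding sobolev_norm_sq[OF f s]
      using sum_nonneg[of "{..<s}" "\<lambda>l. (cmod (integral {0..1} (nderiv l f)))\<^sup>2"] by simp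
    then have "L2_norm {0..1} (nderiv s f) \<le> 1"
      using power2_le_imp_le[of "L2_norm {0..1} (nderiv s f)" 1] by simp
    define h where "h l x = periodized s f l x * osc k x" for l x
    have "L2_norm {0..1} (h s) = L2_norm {0..1} (periodized s f s)"
      unfolding L2_norm_def h_def by (simp add: norm_mult)
    with periodized_top_norm_le[OF f s] \<open>L2_norm {0..1} (nderiv s f) \<le> 1\<close>
    have hs: "L2_norm {0..1} (h s) \<le> 1" by simp
    have chain: "periodic_chain s (2 * of_real pi * \<i> * of_int k) h"
      using periodic_chain_periodized[OF f] by (simp add: h_def[abs_def])
    have \<kappa>: "cmod (2 * of_real pi * \<i> * of_int k) = 2 * pi * q"
      by (simp add: norm_mult q_def)
    have cf: "continuous_on {0..1} f"
      using sobolev_continuous[OF f, of 0] s by simp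
    have cj: "continuous_on {0..1} (jump_corrector i 0)" for i
      by (rule L2_primitive_continuous[OF jump_corrector_L2_primitive])
    have int: "(\<lambda>x. u x * osc k x) integrable_on {0..1}" if "continuous_on {0..1} u" for u
      by (intro integrable_continuous_interval continuous_intros osc_continuous that)
    have "osc_integral k f = integral {0..1} (\<lambda>x. f x * osc k x)"
      unfolding osc_integral_eq_integral[OF cf] osc_def ..
    then have "osc_integral k f - A f
        = T f - (\<Sum>i<s. (nderiv i f 1 - nderiv i f 0) * T (jump_corrector i 0))"
      by (simp add: A_eq T_def)
    also have "\<dots> = T (periodized s f 0)"
    proof -
      have "((\<lambda>x. f x * osc k x - (\<Sum>i<s. (nderiv i f 1 - nderiv i f 0) * (jump_corrector i 0 x * osc k x)))
          has_integral integral {0..1} (\<lambda>x. f x * osc k x)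
            - (\<Sum>i<s. (nderiv i f 1 - nderiv i f 0) * integral {0..1} (\<lambda>x. jump_corrector i 0 x * osc k x))) {0..1}"
        by (intro has_integral_diff has_integral_sum has_integral_mult_right integrable_integral int cf cj) auto
      then have i: "integral {0..1} (\<lambda>x. periodized s f 0 x * osc k x) = integral {0..1} (\<lambda>x. f x * osc k x)
            - (\<Sum>i<s. (nderiv i f 1 - nderiv i f 0) * integral {0..1} (\<lambda>x. jump_corrector i 0 x * osc k x))"
        by (simp add: periodized_def left_diff_distrib sum_distrib_right mult.assoc integral_unique)
      have "(\<Sum>j<m. (\<Sum>i<s. (nderiv i f 1 - nderiv i f 0) * jump_corrector i 0 (real j / m)) * osc k (real j / m))
          = (\<Sum>i<s. (nderiv i f 1 - nderiv i f 0) * (\<Sum>j<m. jump_corrector i 0 (real j / m) * osc k (real j / m)))"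
        unfolding sum_distrib_right sum_distrib_left by (subst sum.swap) (simp add: mult.assoc)
      then have "R (periodized s f 0) = R f - (\<Sum>i<s. (nderiv i f 1 - nderiv i f 0) * R (jump_corrector i 0))"
        by (simp add: R_def periodized_def left_diff_distrib sum_subtractf right_diff_distrib
            sum_distrib_left[of w] mult.left_commute[of w])
      with i show ?thesis
        by (simp add: T_def right_diff_distrib sum_subtractf)
    qed
    finally have e: "osc_integral k f - A f = T (periodized s f 0)" .
    have pos: "0 < real m + q" using m by (simp add: q_def)
    show ?thesis
    proof (cases "2 * q < m")
      case True
      have "T (periodized s f 0) = integral {0..1} (h 0) - fold_period m (h 0) 0"
        using True by (simp add: T_def R_def w_def fold_period_def h_def[abs_def])
      then have "cmod (osc_integral k f - A f) \<le> 2 * (L2_norm {0..1} (h s) / (2 * pi * (real m - q)) ^ s)"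
        using periodic_chain_aliasing_bound[OF chain s m \<kappa>] True e by (simp add: q_def)
      also have "\<dots> \<le> 2 * (1 / (2 * pi * (real m - q)) ^ s)"
        using hs True by (intro mult_left_mono divide_right_mono) (auto simp: q_def)
      also have "\<dots> \<le> 2 * ((3 / (2 * pi)) ^ s * (1 / (real m + q) ^ s))"
        using pos True by (intro mult_left_mono rate_bound) auto
      finally show ?thesis by (simp add: mult.commute)
    next
      case False
      then have q0: "q > 0" using m by linarith
      have "T (periodized s f 0) = integral {0..1} (h 0)"
        using False by (simp add: T_def R_def w_def h_def[abs_def])
      then have "(2 * pi * q) ^ s * cmod (osc_integral k f - A f) \<le> 1"
        using periodic_chain_integral_bound[OF chain s] hs e unfolding \<kappa> by simp
      then have "cmod (osc_integral k f - A f) \<le> 1 / (2 * pi * q) ^ s"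
        using q0 by (simp add: pos_le_divide_eq mult.commute)
      also have "\<dots> \<le> (3 / (2 * pi)) ^ s * (1 / (real m + q) ^ s)"
        using pos False by (intro rate_bound) auto
      also have "\<dots> \<le> (3 / (2 * pi)) ^ s * (2 / (real m + q) ^ s)"
        using pos by (intro mult_left_mono divide_right_mono) auto
      finally show ?thesis .
    qed
  qed
  have "min_error n k s \<le> worst_case_error (sobolev s) s k A"
    unfolding min_error_def by (rule INF_lower[OF alg])
  also have "\<dots> \<le> ereal ((3 / (2 * pi)) ^ s * (2 / (real m + q) ^ s))"
    unfolding worst_case_error_def by (rule SUP_least) (use err in auto)
  finally show ?thesis unfolding X .
qed

section \<open>A smooth bump and smooth Sobolev functions\<close>

lemma power_Suc_dvd_pderiv:
  fixes a p :: "real poly"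
  assumes "a ^ Suc n dvd p" shows "a ^ n dvd pderiv p"
proof -
  obtain q where q: "p = a ^ Suc n * q" using assms by blast
  have "pderiv p = a ^ n * (a * pderiv q + smult (of_nat (Suc n)) (pderiv a) * q)"
    unfolding q pderiv_mult pderiv_power_Suc by (simp add: algebra_simps)
  then show ?thesis by simp
qed

lemma power_dvd_pderiv_funpow:
  fixes a p :: "real poly"
  assumes "a ^ (n + l) dvd p" shows "a ^ n dvd (pderiv ^^ l) p"
  using assms
proof (induction l arbitrary: n)
  case (Suc l)
  have "a ^ Suc n dvd (pderiv ^^ l) p"
    by (rule Suc.IH) (use Suc.prems in simp)
  then show ?case using power_Suc_dvd_pderiv by simp
qed simp

text \<open>The functions are the derivatives of \<open>(x (1 - x))\<^sup>s\<^sup>+\<^sup>2\<close>, cut off outside the unit interval. The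
  exponent makes all derivatives up to order \<open>s + 1\<close> vanish at 0 and 1, so that cutting off preserves
  differentiability of those up to order \<open>s\<close>.\<close>

lemma smooth_bump_exists:
  "\<exists>\<Phi> :: nat \<Rightarrow> real \<Rightarrow> real. (\<forall>l\<le>s. \<forall>x. (\<Phi> l has_real_derivative \<Phi> (Suc l) x) (at x)) \<and>
     (\<forall>l\<le>s. \<forall>x. x \<notin> {0<..<1} \<longrightarrow> \<Phi> l x = 0) \<and> (\<forall>x. 0 \<le> \<Phi> 0 x) \<and> 0 < \<Phi> 0 (1 / 2)"
proof -
  define p :: "real poly" where "p = [:0, 1, -1:] ^ (s + 2)"
  define \<Phi> where "\<Phi> l x = (if x \<in> {0<..<1} then poly ((pderiv ^^ l) p) x else 0)" for l x
  have van: "poly ((pderiv ^^ l) p) x0 = 0" if "l \<le> Suc s" "x0 = 0 \<or> x0 = 1" for l x0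
  proof -
    have "[:0, 1, -1:] ^ (1 + l) dvd p"
      unfolding p_def using that by (intro le_imp_power_dvd) auto
    then have "[:0, 1, -1:] ^ 1 dvd (pderiv ^^ l) p" by (rule power_dvd_pderiv_funpow)
    then obtain r where "(pderiv ^^ l) p = [:0, 1, -1:] * r" by auto
    then show ?thesis using that(2) by auto
  qed
  have d: "(\<Phi> l has_real_derivative \<Phi> (Suc l) x) (at x)" if l: "l \<le> s" for l x
  proof -
    let ?q = "(pderiv ^^ l) p"
    have dq: "(poly ?q has_real_derivative poly ((pderiv ^^ Suc l) p) x) (at x)"
      using poly_DERIV[of ?q x] by simp
    consider "x \<in> {0<..<1}" | "x = 0 \<or> x = 1" | "x \<in> - {0..1}" by force
    then show ?thesis
    proof cases
      case 1
      have "(\<Phi> l has_real_derivative poly ((pderiv ^^ Suc l) p) x) (at x)"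
        by (rule has_field_derivative_transform_within_open[OF dq, of "{0<..<1}"])
           (use 1 in \<open>auto simp: \<Phi>_def\<close>)
      then show ?thesis using 1 by (simp add: \<Phi>_def)
    next
      case 2
      have q0: "poly ?q x = 0" "poly ((pderiv ^^ Suc l) p) x = 0"
        using van[of l x] van[of "Suc l" x] 2 l by auto
      have "((\<lambda>y. (poly ?q y - poly ?q x) / (y - x)) \<longlongrightarrow> 0) (at x)"
        using dq q0(2) unfolding has_field_derivative_iff by simp
      \<comment> \<open>The difference quotients of the cut-off function are dominated by those of the polynomial.\<close>
      from tendsto_rabs_zero[OF this]
      have "((\<lambda>y. (\<Phi> l y - \<Phi> l x) / (y - x)) \<longlongrightarrow> 0) (at x)"
      proof (rule Lim_null_comparison[rotated], intro always_eventually allI)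
        fix y
        have "\<Phi> l x = 0" using 2 by (auto simp: \<Phi>_def)
        then show "norm ((\<Phi> l y - \<Phi> l x) / (y - x)) \<le> \<bar>(poly ?q y - poly ?q x) / (y - x)\<bar>"
          using q0 by (auto simp: \<Phi>_def)
      qed
      then have "(\<Phi> l has_real_derivative 0) (at x)"
        unfolding has_field_derivative_iff .
      then show ?thesis using 2 by (auto simp: \<Phi>_def)
    next
      case 3
      have "(\<Phi> l has_real_derivative 0) (at x)"
        by (rule has_field_derivative_transform_within_open[OF DERIV_const, of "- {0..1}"])
           (use 3 in \<open>auto simp: \<Phi>_def\<close>)
      then show ?thesis using 3 by (auto simp: \<Phi>_def)
    qed
  qed
  have p_eq: "poly p x = (x * (1 - x)) ^ (s + 2)" for x
    by (simp add: p_def algebra_simps del: power_Suc)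
  have nonneg: "0 \<le> \<Phi> 0 x" for x
    by (simp add: \<Phi>_def p_eq)
  have "0 < \<Phi> 0 (1 / 2)" by (simp add: \<Phi>_def p_eq)
  with d nonneg show ?thesis by (intro exI[of _ \<Phi>]) (auto simp: \<Phi>_def)
qed

text \<open>Candidates \<open>D l\<close> for the derivatives are easier to write down than to compute from the iterated
  one-sided derivative; this lemma identifies the two.\<close>

lemma nderiv_eq_chain:
  assumes d: "\<And>l x. l < s \<Longrightarrow> x \<in> {0..1} \<Longrightarrow> (D l has_vector_derivative D (Suc l) x) (at x within {0..1})"
    and l: "l \<le> s" and x: "x \<in> {0..1}"
  shows "nderiv l (D 0) x = D l x"
  using l x
proof (induction l arbitrary: x)
  case (Suc l)
  have "(nderiv l (D 0) has_vector_derivative D (Suc l) x) (at x within {0..1})"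
    by (rule has_vector_derivative_transform[OF Suc.prems(2) _ d]) (use Suc in auto)
  then have "vector_derivative (nderiv l (D 0)) (at x within cbox 0 1) = D (Suc l) x"
    using Suc.prems(2) by (intro vector_derivative_within_cbox) auto
  then show ?case by (simp add: nderiv_Suc)
qed simp

text \<open>The derivative of order \<open>s - 1\<close> is Lipschitz continuous, hence absolutely continuous.\<close>

lemma smooth_chain_in_sobolev:
  assumes s: "s \<ge> 1"
    and d: "\<And>l x. l < s \<Longrightarrow> x \<in> {0..1} \<Longrightarrow> (D l has_vector_derivative D (Suc l) x) (at x within {0..1})"
    and c: "continuous_on {0..1} (D s)"
  shows "D 0 \<in> sobolev s"
proof -
  note nd = nderiv_eq_chain[of s D, OF d]
  have diff: "nderiv l (D 0) differentiable (at x within {0..1})" if "l < s" "x \<in> {0..1}" for l x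
  proof -
    have "(nderiv l (D 0) has_vector_derivative D (Suc l) x) (at x within {0..1})"
      by (rule has_vector_derivative_transform[OF that(2) _ d]) (use that nd in auto)
    then show ?thesis by (auto simp: has_vector_derivative_def differentiable_def)
  qed
  obtain r where r: "s = Suc r" using s by (cases s) auto
  have prim: "L2_primitive (D r) (D s)"
    using d[of r] c r by (intro L2_primitive_C1) auto
  obtain K where K: "\<And>x. x \<in> {0..1} \<Longrightarrow> cmod (D s x) \<le> K"
    using compact_imp_bounded[OF compact_continuous_image[OF c compact_Icc]] unfolding bounded_iff by blast
  have K0: "0 \<le> K" using order_trans[OF norm_ge_zero K[of 0]] by simp
  have lip: "dist (nderiv r (D 0) a) (nderiv r (D 0) b) \<le> K * (b - a)" if "0 \<le> a" "a \<le> b" "b \<le> 1" for a b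
  proof -
    have "cmod (D r b - D r a) \<le> K * measure lborel {a..b}"
      by (rule has_integral_bound_real[OF K0 finite.emptyI L2_primitiveD[OF prim that]])
         (use that K in auto)
    then show ?thesis using nd[of r a] nd[of r b] that r by (simp add: dist_norm norm_minus_commute)
  qed
  have "abs_continuous_on {0..1} (nderiv r (D 0))"
    unfolding abs_continuous_on_def
  proof (intro allI impI)
    fix \<epsilon> :: real assume e: "\<epsilon> > 0"
    show "\<exists>\<delta>>0. \<forall>(m::nat) a b.
        (\<forall>i<m. a i \<le> b i \<and> {a i..b i} \<subseteq> {0..1}) \<and> disjoint_family_on (\<lambda>i. {a i<..<b i}) {..<m} \<and>
        (\<Sum>i<m. b i - a i) < \<delta> \<longrightarrow> (\<Sum>i<m. dist (nderiv r (D 0) (a i)) (nderiv r (D 0) (b i))) < \<epsilon>"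
    proof (intro exI[of _ "\<epsilon> / (K + 1)"] conjI allI impI)
      show "0 < \<epsilon> / (K + 1)" using e K0 by simp
      fix m :: nat and a b :: "nat \<Rightarrow> real"
      assume h: "(\<forall>i<m. a i \<le> b i \<and> {a i..b i} \<subseteq> {0..1}) \<and> disjoint_family_on (\<lambda>i. {a i<..<b i}) {..<m} \<and>
        (\<Sum>i<m. b i - a i) < \<epsilon> / (K + 1)"
      have "(\<Sum>i<m. dist (nderiv r (D 0) (a i)) (nderiv r (D 0) (b i))) \<le> (\<Sum>i<m. K * (b i - a i))"
        using h by (intro sum_mono lip) auto
      also have "\<dots> = K * (\<Sum>i<m. b i - a i)" by (simp add: sum_distrib_left)
      also have "\<dots> \<le> K * (\<epsilon> / (K + 1))" using h K0 by (intro mult_left_mono) auto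
      also have "\<dots> < \<epsilon>" using e K0 by (simp add: field_simps)
      finally show "(\<Sum>i<m. dist (nderiv r (D 0) (a i)) (nderiv r (D 0) (b i))) < \<epsilon>" .
    qed
  qed
  moreover have "square_integrable (nderiv s (D 0))"
  proof -
    have cn: "continuous_on {0..1} (nderiv s (D 0))"
      by (rule continuous_on_eq[OF c], rule nd[symmetric]) auto
    have "nderiv s (D 0) \<in> borel_measurable (lebesgue_on {0..1})"
      using cn by (simp add: continuous_imp_measurable_on_sets_lebesgue)
    moreover have "set_integrable lebesgue {0..1} (\<lambda>x. (cmod (nderiv s (D 0) x))\<^sup>2)"
      by (intro absolutely_integrable_continuous_real continuous_intros cn)
    ultimately show ?thesis
      by (simp add: square_integrable_def set_borel_measurable_def borel_measurable_restrict_space_iff)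
  qed
  ultimately show ?thesis
    unfolding sobolev_def using diff r by auto
qed

lemma smooth_chain_sobolev_norm_le:
  assumes s: "s \<ge> 1"
    and d: "\<And>l x. l < s \<Longrightarrow> x \<in> {0..1} \<Longrightarrow> (D l has_vector_derivative D (Suc l) x) (at x within {0..1})"
    and c: "continuous_on {0..1} (D s)"
    and bound: "\<And>l x. l \<le> s \<Longrightarrow> x \<in> {0..1} \<Longrightarrow> cmod (D l x) \<le> K"
  shows "sobolev_norm s (D 0) \<le> sqrt (s + 1) * K"
proof -
  note nd = nderiv_eq_chain[of s D, OF d]
  have f: "D 0 \<in> sobolev s"
    by (rule smooth_chain_in_sobolev[OF s d c])
  have K0: "0 \<le> K" using order_trans[OF norm_ge_zero bound[of 0 0]] by simp
  have prim: "L2_primitive (nderiv l (D 0)) (nderiv (Suc l) (D 0))" if "l < s" for l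
    by (rule sobolev_L2_primitive[OF f that])
  have mean: "(cmod (integral {0..1} (nderiv l (D 0))))\<^sup>2 \<le> K\<^sup>2" if l: "l < s" for l
  proof -
    have "nderiv l (D 0) integrable_on {0..1}"
      by (intro integrable_continuous_interval sobolev_continuous[OF f l])
    from has_integral_bound_real[OF K0 finite.emptyI integrable_integral[OF this]]
    have "cmod (integral {0..1} (nderiv l (D 0))) \<le> K"
      using bound[of l] nd[of l] l by simp
    then show ?thesis by (intro power_mono) auto
  qed
  have cn: "continuous_on {0..1} (nderiv s (D 0))"
    by (rule continuous_on_eq[OF c], rule nd[symmetric]) auto
  have "(L2_norm {0..1} (nderiv s (D 0)))\<^sup>2 \<le> integral {0..1} (\<lambda>x::real. K\<^sup>2)"
    unfolding L2_norm_sq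
  proof (rule integral_le)
    show "(\<lambda>x. (cmod (nderiv s (D 0) x))\<^sup>2) integrable_on {0..1}"
      by (intro integrable_continuous_interval continuous_intros cn)
    show "(cmod (nderiv s (D 0) x))\<^sup>2 \<le> K\<^sup>2" if "x \<in> {0..1}" for x
      using bound[of s x] nd[of s x] that by (intro power_mono) auto
  qed auto
  then have top: "(L2_norm {0..1} (nderiv s (D 0)))\<^sup>2 \<le> K\<^sup>2" by simp
  have "Re (sobolev_inner s (D 0) (D 0)) \<le> (\<Sum>l<s. K\<^sup>2) + K\<^sup>2"
    unfolding sobolev_norm_sq[OF f s] by (intro add_mono sum_mono mean top) auto
  also have "\<dots> = (s + 1) * K\<^sup>2" by (simp add: algebra_simps)
  finally have "sobolev_norm s (D 0) \<le> sqrt ((s + 1) * K\<^sup>2)"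
    unfolding sobolev_norm_def by (rule real_sqrt_le_mono)
  then show ?thesis using K0 by (simp add: real_sqrt_mult)
qed

section \<open>The lower bound\<close>

lemma Re_cnj_osc_mult_osc: "Re (cnj (osc k y) * osc k x) = cos (2 * pi * (real_of_int k * (x - y)))"
proof -
  have osc_cis: "osc k x = cis (- (2 * pi * (real_of_int k * x)))" for x
    by (simp add: osc_def cis_conv_exp algebra_simps)
  have "- (- (2 * pi * (real_of_int k * y))) + - (2 * pi * (real_of_int k * x))
      = - (2 * pi * (real_of_int k * (x - y)))"
    by (simp add: algebra_simps)
  then show ?thesis unfolding osc_cis cis_cnj cis_mult by simp
qed

lemma cos_ge_half: "\<bar>t\<bar> \<le> pi / 3 \<Longrightarrow> 1 / 2 \<le> cos t"
  using cos_monotone_0_pi_le[of "\<bar>t\<bar>" "pi / 3"] pi_gt_zero by (simp add: cos_60)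

text \<open>With \<open>M = 4 (n + |k|)\<close>, at least three quarters of the cells of length \<open>1/M\<close> contain no node in
  their interior. The function is the sum of bumps on these cells, each with the phase
  \<open>e\<^sup>2\<^sup>\<pi>\<^sup>i\<^sup>k\<^sup>y\<close> at the midpoint \<open>y\<close> of its cell. After modulation the real part on such a cell is at
  least half of the bump, so the integral is at least \<open>3/8\<close> of the integral of one bump at unit
  scale, whereas the derivative of order \<open>l \<le> s\<close> is at most \<open>C M\<^sup>s\<close>.\<close>

lemma fooling_function_exists:
  assumes s: "s \<ge> 1"
  shows "\<exists>c>0. \<forall>(k::int) (n::nat) (x::nat \<Rightarrow> real). n \<ge> 1 \<longrightarrow>
    (\<exists>f\<in>periodic_sobolev s. sobolev_norm s f \<le> 1 \<and>
       (\<forall>l<s. \<forall>j\<in>{1..n}. x j \<in> {0..1} \<longrightarrow> nderiv l f (x j) = 0) \<and>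
       c / (real n + \<bar>real_of_int k\<bar>) ^ s \<le> cmod (osc_integral k f))"
proof -
  obtain \<Phi> :: "nat \<Rightarrow> real \<Rightarrow> real"
    where d\<Phi>: "\<And>l x. l \<le> s \<Longrightarrow> (\<Phi> l has_real_derivative \<Phi> (Suc l) x) (at x)"
      and supp: "\<And>l x. l \<le> s \<Longrightarrow> x \<notin> {0<..<1} \<Longrightarrow> \<Phi> l x = 0"
      and nonneg: "\<And>x. 0 \<le> \<Phi> 0 x" and half: "0 < \<Phi> 0 (1 / 2)"
    using smooth_bump_exists[of s] by blast
  have c\<Phi>: "continuous_on S (\<Phi> l)" if "l \<le> s" for l S
    by (rule DERIV_continuous_on) (rule has_field_derivative_at_within[OF d\<Phi>[OF that]])
  have "\<exists>B. \<forall>x. \<bar>\<Phi> l x\<bar> \<le> B" if ls: "l \<le> s" for l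
  proof -
    obtain B where B: "\<forall>x\<in>{0..1}. \<bar>\<Phi> l x\<bar> \<le> B"
      using compact_imp_bounded[OF compact_continuous_image[OF c\<Phi>[OF ls] compact_Icc, of 0 1]]
      unfolding bounded_iff by auto
    have "\<bar>\<Phi> l x\<bar> \<le> \<bar>B\<bar>" for x
      using bspec[OF B, of x] supp[OF ls, of x] by (cases "x \<in> {0<..<1}") auto
    then show ?thesis by blast
  qed
  then obtain B where B: "\<And>l x. l \<le> s \<Longrightarrow> \<bar>\<Phi> l x\<bar> \<le> B l" by metis
  define C where "C = 1 + (\<Sum>l\<le>s. \<bar>B l\<bar>)"
  have C0: "C > 0" unfolding C_def by (intro add_pos_nonneg sum_nonneg) auto
  have C: "\<bar>\<Phi> l x\<bar> \<le> C" if "l \<le> s" for l x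
  proof -
    have "\<bar>B l\<bar> \<le> (\<Sum>l\<le>s. \<bar>B l\<bar>)" using that by (intro member_le_sum) auto
    with B[OF that, of x] show ?thesis by (simp add: C_def)
  qed
  define I0 where "I0 = integral {0..1} (\<Phi> 0)"
  have i\<Phi>: "\<Phi> 0 integrable_on {0..1}" by (intro integrable_continuous_interval c\<Phi>) simp
  have I0: "I0 > 0"
  proof -
    have "I0 \<ge> 0" unfolding I0_def using nonneg by (intro integral_nonneg i\<Phi>) auto
    moreover have "I0 \<noteq> 0"
    proof
      assume "I0 = 0"
      then have "(\<Phi> 0 has_integral 0) (cbox 0 1)"
        using integrable_integral[OF i\<Phi>] by (simp add: I0_def)
      then have "\<Phi> 0 (1 / 2) = 0"
        using has_integral_0_cbox_imp_0[of 0 1 "\<Phi> 0" "1 / 2"] c\<Phi>[of 0] nonneg by simp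
      with half show False by simp
    qed
    ultimately show ?thesis by simp
  qed
  define c where "c = (3 / 8) * I0 / (C * sqrt (s + 1) * 4 ^ s)"
  have "c > 0" unfolding c_def using I0 C0 by simp
  moreover have "\<exists>f\<in>periodic_sobolev s. sobolev_norm s f \<le> 1 \<and>
       (\<forall>l<s. \<forall>j\<in>{1..n}. x j \<in> {0..1} \<longrightarrow> nderiv l f (x j) = 0) \<and>
       c / (real n + \<bar>real_of_int k\<bar>) ^ s \<le> cmod (osc_integral k f)"
    if n: "n \<ge> 1" for k :: int and n :: nat and x :: "nat \<Rightarrow> real"
  proof -
    define M where "M = 4 * (n + nat \<bar>k\<bar>)"
    have Mr: "real M = 4 * (real n + \<bar>real_of_int k\<bar>)" by (simp add: M_def)
    have M0: "M > 0" using n by (simp add: M_def)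
    have M1: "real M \<ge> 1" using M0 by linarith
    define F where "F = {..<M} - (\<lambda>j. nat \<lfloor>M * x j\<rfloor>) ` {1..n}"
    have finF: "finite F" by (simp add: F_def)
    have "card F \<ge> M - n"
    proof -
      have "card ((\<lambda>j. nat \<lfloor>M * x j\<rfloor>) ` {1..n}) \<le> n"
        using card_image_le[of "{1..n}" "\<lambda>j. nat \<lfloor>M * x j\<rfloor>"] by simp
      moreover have "card {..<M} - card ((\<lambda>j. nat \<lfloor>M * x j\<rfloor>) ` {1..n}) \<le> card F"
        unfolding F_def by (rule diff_card_le_card_Diff) simp
      ultimately show ?thesis by simp
    qed
    then have cardF: "real (card F) \<ge> 3 / 4 * real M" unfolding M_def by simp
    define y where "y i = (real i + 1 / 2) / M" for i :: nat
    \<comment> \<open>The normalization: the norm is at most \<open>\<surd>(s + 1)\<close> times a common bound on all derivatives.\<close>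
    define b where "b = 1 / (C * real M ^ s * sqrt (s + 1))"
    have b0: "b > 0" unfolding b_def using C0 M0 by simp
    define D where "D l t = of_real b * (\<Sum>i\<in>F. cnj (osc k (y i)) * of_real (real M ^ l * \<Phi> l (real M * t - real i)))" for l and t :: real
    \<comment> \<open>The supports do not overlap: the cell of a point determines the only bump that can be
      nonzero there.\<close>
    have cell: "i = nat \<lfloor>M * t\<rfloor>" if "l \<le> s" "\<Phi> l (real M * t - real i) \<noteq> 0" for i l and t :: real
    proof -
      have "M * t - real i \<in> {0<..<1}" using supp[OF that(1)] that(2) by blast
      then have "\<lfloor>M * t\<rfloor> = int i" by (intro floor_unique) auto
      then show ?thesis by simp
    qed
    have dD: "(D l has_vector_derivative D (Suc l) t) (at t within {0..1})" if l: "l < s" for l t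
    proof -
      have "((\<lambda>t. of_real (real M ^ l * \<Phi> l (real M * t - real i))) has_vector_derivative
          complex_of_real (real M ^ Suc l * \<Phi> (Suc l) (real M * t - real i))) (at t within {0..1})" for i
      proof -
        have "((\<lambda>t. real M ^ l * \<Phi> l (real M * t - real i)) has_real_derivative
            real M ^ l * (\<Phi> (Suc l) (real M * t - real i) * M)) (at t)"
          using l by (auto intro!: derivative_eq_intros DERIV_chain2[OF d\<Phi>[of l]])
        then have "((\<lambda>t. real M ^ l * \<Phi> l (real M * t - real i)) has_vector_derivative
            real M ^ Suc l * \<Phi> (Suc l) (real M * t - real i)) (at t within {0..1})"
          using has_vector_derivative_at_within
          by (auto simp: has_real_derivative_iff_has_vector_derivative mult_ac)
        then show ?thesis by (rule bounded_linear.has_vector_derivative[OF bounded_linear_of_real])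
      qed
      then show ?thesis
        unfolding D_def
        by (intro has_vector_derivative_mult_right has_vector_derivative_sum)
    qed
    have cD: "continuous_on {0..1} (D s)"
      unfolding D_def by (intro continuous_intros continuous_on_compose2[OF c\<Phi>[OF order_refl, of UNIV]]) auto
    have boundD: "cmod (D l t) \<le> 1 / sqrt (s + 1)" if l: "l \<le> s" for l t
    proof -
      have "cmod (\<Sum>i\<in>F. cnj (osc k (y i)) * of_real (real M ^ l * \<Phi> l (real M * t - real i)))
          \<le> (\<Sum>i\<in>F. if i = nat \<lfloor>M * t\<rfloor> then real M ^ s * C else 0)"
      proof (rule sum_norm_le)
        fix i assume "i \<in> F"
        show "cmod (cnj (osc k (y i)) * of_real (real M ^ l * \<Phi> l (real M * t - real i)))
            \<le> (if i = nat \<lfloor>M * t\<rfloor> then real M ^ s * C else 0)"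
        proof (cases "i = nat \<lfloor>M * t\<rfloor>")
          case True
          have "real M ^ l * \<bar>\<Phi> l (real M * t - real i)\<bar> \<le> real M ^ s * C"
            using M1 l by (intro mult_mono power_increasing C) auto
          with True show ?thesis by (simp add: norm_mult norm_power)
        next
          case False
          then have "\<Phi> l (real M * t - real i) = 0" using cell[OF l] by blast
          with False show ?thesis by simp
        qed
      qed
      also have "\<dots> \<le> real M ^ s * C" using finF C0 by (simp add: sum.delta)
      finally have "cmod (D l t) \<le> b * (real M ^ s * C)"
        unfolding D_def using b0 by (simp add: norm_mult)
      also have "\<dots> = 1 / sqrt (s + 1)" using C0 M0 by (simp add: b_def)
      finally show ?thesis .
    qed
    have nd: "nderiv l (D 0) t = D l t" if "l \<le> s" "t \<in> {0..1}" for l t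
      using that by (intro nderiv_eq_chain[where D = D and s = s] dD)
    have zero: "D l t = 0" if "l \<le> s" "\<And>i. i \<in> F \<Longrightarrow> \<Phi> l (real M * t - real i) = 0" for l t
      unfolding D_def using that(2) by simp
    have sob: "D 0 \<in> sobolev s" by (rule smooth_chain_in_sobolev[where D = D, OF s dD cD])
    have "D l 0 = 0" "D l 1 = 0" if l: "l < s" for l
    proof -
      show "D l 0 = 0" using l by (intro zero supp) auto
      show "D l 1 = 0"
      proof (intro zero supp)
        fix i assume "i \<in> F"
        then have "real i + 1 \<le> real M" unfolding F_def by auto
        then show "real M * 1 - real i \<notin> {0<..<1}" by simp
      qed (use l in auto)
    qed
    then have per: "D 0 \<in> periodic_sobolev s"
      using sob nd by (simp add: periodic_sobolev_def)
    have norm: "sobolev_norm s (D 0) \<le> 1"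
      using smooth_chain_sobolev_norm_le[where D = D, OF s dD cD boundD] by simp
    have nodes: "nderiv l (D 0) (x j) = 0" if "l < s" "j \<in> {1..n}" "x j \<in> {0..1}" for l j
    proof -
      have "D l (x j) = 0"
      proof (rule zero)
        fix i assume i: "i \<in> F"
        show "\<Phi> l (M * x j - real i) = 0"
        proof (rule ccontr)
          assume "\<Phi> l (M * x j - real i) \<noteq> 0"
          then have "i = nat \<lfloor>M * x j\<rfloor>" using cell[where l = l and i = i and t = "x j"] that by simp
          with i that show False by (auto simp: F_def)
        qed
      qed (use that in simp)
      then show ?thesis using nd that by simp
    qed
    have "3 / 8 * b * I0 \<le> cmod (osc_integral k (D 0))"
    proof -
      have c0: "continuous_on {0..1} (D 0)"
        using sobolev_continuous[OF sob, of 0] s by simp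
      have int: "((\<lambda>t. D 0 t * osc k t) has_integral osc_integral k (D 0)) {0..1}"
        unfolding osc_integral_eq_integral[OF c0] osc_def[symmetric]
        by (intro integrable_integral integrable_continuous_interval continuous_intros c0 osc_continuous)
      have re: "((\<lambda>t. Re (D 0 t * osc k t)) has_integral Re (osc_integral k (D 0))) {0..1}"
        using has_integral_linear[OF int bounded_linear_Re] by (simp add: o_def)
      have low: "((\<lambda>t. b / 2 * (\<Sum>i\<in>F. \<Phi> 0 (real M * t - real i))) has_integral b / 2 * (\<Sum>i\<in>F. I0 / M)) {0..1}"
      proof (intro has_integral_mult_right has_integral_sum finF)
        fix i assume "i \<in> F"
        then have i: "real i + 1 \<le> real M" unfolding F_def by auto
        have "(\<Phi> 0 has_integral I0) (cbox 0 1)" using integrable_integral[OF i\<Phi>] by (simp add: I0_def)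
        from has_integral_affinity'[OF this, of "real M" "- real i"] M0
        have h: "((\<lambda>t. \<Phi> 0 (real M * t - real i)) has_integral I0 / M) {real i / M..(1 + real i) / M}"
          by (simp add: divide_inverse mult.commute)
        show "((\<lambda>t. \<Phi> 0 (real M * t - real i)) has_integral I0 / M) {0..1}"
        proof (rule has_integral_on_superset[OF h])
          show "{real i / M..(1 + real i) / M} \<subseteq> {0..1}" using i M0 by (auto simp: field_simps intro: order_trans)
          show "\<Phi> 0 (real M * t - real i) = 0" if "t \<notin> {real i / M..(1 + real i) / M}" for t
            using that M0 by (intro supp) (auto simp: field_simps)
        qed
      qed
      have "b / 2 * (\<Sum>i\<in>F. I0 / M) \<le> Re (osc_integral k (D 0))"
      proof (rule has_integral_le[OF low re])
        fix t :: real assume "t \<in> {0..1}"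
        have "b / 2 * (\<Sum>i\<in>F. \<Phi> 0 (real M * t - real i)) = b * (\<Sum>i\<in>F. 1 / 2 * \<Phi> 0 (real M * t - real i))"
          by (simp add: sum_divide_distrib[symmetric])
        also have "\<dots> \<le> b * (\<Sum>i\<in>F. Re (cnj (osc k (y i)) * osc k t) * \<Phi> 0 (real M * t - real i))"
        proof (intro mult_left_mono sum_mono)
          fix i
          show "1 / 2 * \<Phi> 0 (real M * t - real i) \<le> Re (cnj (osc k (y i)) * osc k t) * \<Phi> 0 (real M * t - real i)"
          proof (cases "\<Phi> 0 (real M * t - real i) = 0")
            case False
            then have "M * t - real i \<in> {0<..<1}" using supp[of 0] by blast
            moreover have "real M * (t - y i) = (real M * t - real i) - 1 / 2"
              using M0 by (simp add: y_def field_simps)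
            ultimately have "\<bar>real M * (t - y i)\<bar> \<le> 1 / 2" unfolding greaterThanLessThan_iff by linarith
            then have "real M * \<bar>t - y i\<bar> \<le> 1 / 2" by (simp add: abs_mult)
            then have "real M * (\<bar>real_of_int k\<bar> * \<bar>t - y i\<bar>) \<le> \<bar>real_of_int k\<bar> * (1 / 2)"
              by (metis abs_ge_zero mult.left_commute mult_left_mono)
            also have "\<dots> \<le> real M * (1 / 8)" unfolding Mr by simp
            finally have "\<bar>real_of_int k\<bar> * \<bar>t - y i\<bar> \<le> 1 / 8" using M0 by simp
            then have "2 * pi * (\<bar>real_of_int k\<bar> * \<bar>t - y i\<bar>) \<le> 2 * pi * (1 / 8)"
              by (intro mult_left_mono) auto
            then have "\<bar>2 * pi * (real_of_int k * (t - y i))\<bar> \<le> pi / 3"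
              using pi_gt_zero by (simp add: abs_mult)
            from cos_ge_half[OF this] show ?thesis
              unfolding Re_cnj_osc_mult_osc by (intro mult_right_mono nonneg)
          qed simp
        qed (use b0 in simp)
        also have "\<dots> = Re (D 0 t * osc k t)"
        proof -
          have Re_lin: "Re (of_real b * (\<Sum>i\<in>F. of_real (r i) * z i)) = b * (\<Sum>i\<in>F. r i * Re (z i))"
            for r and z :: "nat \<Rightarrow> complex"
            by (simp add: Re_sum)
          have "D 0 t * osc k t = of_real b * (\<Sum>i\<in>F. of_real (\<Phi> 0 (real M * t - real i)) * (cnj (osc k (y i)) * osc k t))"
            by (simp add: D_def sum_distrib_left sum_distrib_right mult_ac)
          then have "Re (D 0 t * osc k t) = b * (\<Sum>i\<in>F. \<Phi> 0 (real M * t - real i) * Re (cnj (osc k (y i)) * osc k t))"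
            by (simp only: Re_lin)
          then show ?thesis by (simp only: mult.commute)
        qed
        finally show "b / 2 * (\<Sum>i\<in>F. \<Phi> 0 (real M * t - real i)) \<le> Re (D 0 t * osc k t)" .
      qed
      moreover have "3 / 8 * b * I0 \<le> b / 2 * (\<Sum>i\<in>F. I0 / M)"
      proof -
        have "3 / 8 * b * I0 = b / 2 * ((3 / 4 * real M) * (I0 / M))" using M0 by simp
        also have "\<dots> \<le> b / 2 * (card F * (I0 / M))"
          using b0 I0 cardF by (intro mult_left_mono mult_right_mono) auto
        finally show ?thesis by simp
      qed
      ultimately show ?thesis using complex_Re_le_cmod[of "osc_integral k (D 0)"] by linarith
    qed
    also have "3 / 8 * b * I0 = c / (real n + \<bar>real_of_int k\<bar>) ^ s"
      unfolding b_def c_def Mr power_mult_distrib by (simp add: field_simps)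
    finally show ?thesis using per norm nodes by blast
  qed
  ultimately show ?thesis by blast
qed

lemma min_error_periodic_lower_bound:
  assumes s: "s \<ge> 1"
  shows "\<exists>c>0. \<forall>(k::int) (n::nat). n \<ge> 1 \<longrightarrow>
    ereal (c / (real n + \<bar>real_of_int k\<bar>) ^ s) \<le> min_error_periodic n k s"
proof -
  obtain c where c: "c > 0" and fool: "\<And>(k::int) (n::nat) (x::nat \<Rightarrow> real). n \<ge> 1 \<Longrightarrow>
    (\<exists>f\<in>periodic_sobolev s. sobolev_norm s f \<le> 1 \<and>
       (\<forall>l<s. \<forall>j\<in>{1..n}. x j \<in> {0..1} \<longrightarrow> nderiv l f (x j) = 0) \<and>
       c / (real n + \<bar>real_of_int k\<bar>) ^ s \<le> cmod (osc_integral k f))"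
    using fooling_function_exists[OF s] by (elim exE conjE) blast
  have "ereal (c / (real n + \<bar>real_of_int k\<bar>) ^ s) \<le> min_error_periodic n k s" if n: "n \<ge> 1" for k n
    unfolding min_error_periodic_def
  proof (rule INF_greatest)
    fix A assume "A \<in> algorithms n s"
    then obtain a l x where A: "\<forall>j\<in>{1..n}. l j < s \<and> x j \<in> {0..1}"
      "A = (\<lambda>f. \<Sum>j=1..n. a j * nderiv (l j) f (x j))"
      unfolding algorithms_def mem_Collect_eq by (elim exE conjE)
    obtain f where f: "f \<in> periodic_sobolev s" "sobolev_norm s f \<le> 1"
      "\<forall>l<s. \<forall>j\<in>{1..n}. x j \<in> {0..1} \<longrightarrow> nderiv l f (x j) = 0"
      "c / (real n + \<bar>real_of_int k\<bar>) ^ s \<le> cmod (osc_integral k f)"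
      using fool[OF n, of x k] by blast
    have "A f = 0" unfolding A(2) using A(1) f(3) by (intro sum.neutral) auto
    then have "ereal (c / (real n + \<bar>real_of_int k\<bar>) ^ s) \<le> ereal (cmod (osc_integral k f - A f))"
      using f(4) by simp
    also have "\<dots> \<le> worst_case_error (periodic_sobolev s) s k A"
      unfolding worst_case_error_def by (rule SUP_upper) (use f in auto)
    finally show "ereal (c / (real n + \<bar>real_of_int k\<bar>) ^ s) \<le> worst_case_error (periodic_sobolev s) s k A" .
  qed
  with c show ?thesis by blast
qed

lemma min_error_periodic_le_min_error: "min_error_periodic n k s \<le> min_error n k s"
  unfolding min_error_periodic_def min_error_def
proof (rule INF_mono)
  fix A assume "A \<in> algorithms n s"
  moreover have "worst_case_error (periodic_sobolev s) s k A \<le> worst_case_error (sobolev s) s k A"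
    unfolding worst_case_error_def by (rule SUP_subset_mono) (auto simp: periodic_sobolev_def)
  ultimately show "\<exists>B\<in>algorithms n s. worst_case_error (periodic_sobolev s) s k B \<le> worst_case_error (sobolev s) s k A"
    by blast
qed

section \<open>The theorem\<close>

theorem theorem15:
  fixes s :: nat
  assumes "s \<ge> 1"
  shows "\<exists>c::real. c > 0 \<and>
    (\<forall>(k::int) (n::nat). n \<ge> 1 \<longrightarrow>
       ereal (c / (real n + \<bar>real_of_int k\<bar>) ^ s) \<le> min_error_periodic n k s) \<and>
    (\<forall>(k::int) (n::nat). n \<ge> 2 * s \<longrightarrow>
       ereal (c / (real n + \<bar>real_of_int k\<bar>) ^ s) \<le> min_error n k s \<and>
       min_error n k s \<le>
         ereal ((3 / (2 * pi)) ^ s * (2 / (real n + \<bar>real_of_int k\<bar> - 2 * real s + 1) ^ s)))"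
proof -
  obtain c where c: "c > 0" and lower: "\<forall>(k::int) (n::nat). n \<ge> 1 \<longrightarrow>
      ereal (c / (real n + \<bar>real_of_int k\<bar>) ^ s) \<le> min_error_periodic n k s"
    using min_error_periodic_lower_bound[OF assms] by blast
  have "ereal (c / (real n + \<bar>real_of_int k\<bar>) ^ s) \<le> min_error n k s" if "n \<ge> 2 * s" for k n
  proof -
    have "n \<ge> 1" using that assms by linarith
    then have "ereal (c / (real n + \<bar>real_of_int k\<bar>) ^ s) \<le> min_error_periodic n k s"
      using lower by blast
    also have "\<dots> \<le> min_error n k s" by (rule min_error_periodic_le_min_error)
    finally show ?thesis .
  qed
  with c lower min_error_upper_bound[OF assms] show ?thesis by blast
qed

end
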